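(* Let $G$ be a finitely generated recursively presented group, $A$ a finite alphabet and $X\subset A^G$ an effectively closed subshift. Then there exists a recursively enumerable set of pattern codings $\mathcal C$ with $X=X_{\mathcal C}$ which is maximal for inclusion among all sets of pattern codings defining $X$.
   Context: Let $S\subset G$ be a finite generating set closed under inverses and containing $1_G$; words in $S^*$ represent elements of $G$. $G$ is recursively presented if it has a presentation $\langle S\mid R\rangle$ with $S$ finite and $R\subset S^*$ recursively enumerable. $A^G$ has the product topology and left shift action $(\sigma_g x)_h=x_{g^{-1}h}$; a subshift is a closed shift-invariant subset. Put $[a]_g=\{x\in A^G:x_g=a\}$. A pattern coding over $A$ is a finite set $c$ of pairs $(w,a)$ with $w\in S^*$, $a\in A$. For a set $\mathcal C$ of pattern codings, $X_{\mathcal C}=\bigcap_{g\in G,\,c\in\mathcal C}\big(A^G\setminus\bigcap_{(w,a)\in c}[a]_{gw}\big)$; $\mathcal C$ defines $X$ if $X=X_{\mathcal C}$. $X\subset A^G$ is effectively closed if it is defined by some recursively enumerable set of pattern codings. *)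

theory Defs
  imports "HOL-Algebra.Generated_Groups" "HOL-Analysis.Product_Topology"
    "HOL-Analysis.Function_Topology" "HOL-Library.Nat_Bijection"
begin

section \<open>Recursively enumerable sets\<close>

text \<open>
  \<^term>\<open>recursive_fn k f\<close>: \<^term>\<open>f\<close>, applied to lists of length \<^term>\<open>k\<close>, is a general
  recursive (total mu-recursive) function of \<^term>\<open>k\<close> arguments. Values on lists of any other
  length are irrelevant. Minimisation is only allowed where it yields a total function.
\<close>

inductive recursive_fn :: "nat \<Rightarrow> (nat list \<Rightarrow> nat) \<Rightarrow> bool" where
  zero: "recursive_fn 0 (\<lambda>_. 0)"
| succ: "recursive_fn 1 (\<lambda>xs. Suc (hd xs))"
| proj: "i < k \<Longrightarrow> recursive_fn k (\<lambda>xs. xs ! i)"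
| comp: "recursive_fn (length fs) g \<Longrightarrow> \<forall>f\<in>set fs. recursive_fn k f \<Longrightarrow>
    recursive_fn k (\<lambda>xs. g (map (\<lambda>f. f xs) fs))"
| prim_rec: "recursive_fn k f \<Longrightarrow> recursive_fn (Suc (Suc k)) g \<Longrightarrow>
    recursive_fn (Suc k)
      (\<lambda>xs. rec_nat (f (tl xs)) (\<lambda>n y. g (n # y # tl xs)) (hd xs))"
| minimise: "recursive_fn (Suc k) f \<Longrightarrow> \<forall>xs. length xs = k \<longrightarrow> (\<exists>n. f (n # xs) = 0) \<Longrightarrow>
    recursive_fn k (\<lambda>xs. LEAST n. f (n # xs) = 0)"

definition recursively_enumerable :: "nat set \<Rightarrow> bool" where
  "recursively_enumerable N \<longleftrightarrow>
     N = {} \<or> (\<exists>f. recursive_fn 1 f \<and> N = range (\<lambda>n. f [n]))"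

text \<open>
  Words over a finite set \<^term>\<open>S\<close> are coded by natural numbers through an injective numbering of
  the letters. As \<^term>\<open>S\<close> is finite, any two numberings differ by a recursive map, so recursive
  enumerability does not depend on the numbering. The same applies to pattern codings below.
\<close>

definition word_code :: "('g \<Rightarrow> nat) \<Rightarrow> 'g list \<Rightarrow> nat" where
  "word_code e w = list_encode (map e w)"

definition re_words :: "'g set \<Rightarrow> 'g list set \<Rightarrow> bool" where
  "re_words S L \<longleftrightarrow> (\<exists>e. inj_on e S \<and> recursively_enumerable (word_code e ` L))"

section \<open>Generating sets and recursive presentations\<close>

definition symmetric_generating_set :: "('g, 'm) monoid_scheme \<Rightarrow> 'g set \<Rightarrow> bool" where
  "symmetric_generating_set G S \<longleftrightarrow>
     finite S \<and> S \<subseteq> carrier G \<and> \<one>\<^bsub>G\<^esub> \<in> S \<and> (\<forall>s\<in>S. inv\<^bsub>G\<^esub> s \<in> S) \<and>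
     generate G S = carrier G"

definition word_value :: "('g, 'm) monoid_scheme \<Rightarrow> 'g list \<Rightarrow> 'g" where
  "word_value G w = foldr (\<lambda>s g. s \<otimes>\<^bsub>G\<^esub> g) w \<one>\<^bsub>G\<^esub>"

text \<open>
  The group \<open>\<langle>S | R\<rangle>\<close> as the quotient of the words over \<open>S\<close> and its formal inverses: the letter
  \<^term>\<open>(s, True)\<close> is the generator \<^term>\<open>s\<close> and \<^term>\<open>(s, False)\<close> its formal inverse. A relator is
  a word over \<^term>\<open>S\<close> itself; that a formal inverse agrees with another generator has to follow
  from the relators.
\<close>

inductive presentation_eq ::
  "'g set \<Rightarrow> 'g list set \<Rightarrow> ('g \<times> bool) list \<Rightarrow> ('g \<times> bool) list \<Rightarrow> bool"
  for S :: "'g set" and R :: "'g list set" where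
  refl: "w \<in> lists (S \<times> UNIV) \<Longrightarrow> presentation_eq S R w w"
| sym: "presentation_eq S R u v \<Longrightarrow> presentation_eq S R v u"
| trans: "presentation_eq S R u v \<Longrightarrow> presentation_eq S R v w \<Longrightarrow> presentation_eq S R u w"
| cancel: "u \<in> lists (S \<times> UNIV) \<Longrightarrow> v \<in> lists (S \<times> UNIV) \<Longrightarrow> s \<in> S \<Longrightarrow>
    presentation_eq S R (u @ [(s, b), (s, \<not> b)] @ v) (u @ v)"
| relator: "u \<in> lists (S \<times> UNIV) \<Longrightarrow> v \<in> lists (S \<times> UNIV) \<Longrightarrow> r \<in> R \<Longrightarrow>
    presentation_eq S R (u @ map (\<lambda>s. (s, True)) r @ v) (u @ v)"

definition presentation_rel :: "'g set \<Rightarrow> 'g list set \<Rightarrow> (('g \<times> bool) list) rel" where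
  "presentation_rel S R = {(u, v). presentation_eq S R u v}"

definition presented_group :: "'g set \<Rightarrow> 'g list set \<Rightarrow> (('g \<times> bool) list set) monoid" where
  "presented_group S R =
     \<lparr>carrier = lists (S \<times> UNIV) // presentation_rel S R,
      monoid.mult = (\<lambda>U V. \<Union>u\<in>U. \<Union>v\<in>V. presentation_rel S R `` {u @ v}),
      one = presentation_rel S R `` {[]}\<rparr>"

definition has_presentation ::
  "('g, 'm) monoid_scheme \<Rightarrow> 'g set \<Rightarrow> 'g list set \<Rightarrow> bool" where
  "has_presentation G S R \<longleftrightarrow>
     (\<exists>\<phi> \<in> iso (presented_group S R) G.
        \<forall>s\<in>S. \<phi> (presentation_rel S R `` {[(s, True)]}) = s)"

definition recursively_presented :: "('g, 'm) monoid_scheme \<Rightarrow> bool" where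
  "recursively_presented G \<longleftrightarrow>
     (\<exists>S R. symmetric_generating_set G S \<and> R \<subseteq> lists S \<and> re_words S R \<and> has_presentation G S R)"

section \<open>Subshifts\<close>

definition full_shift :: "('g, 'm) monoid_scheme \<Rightarrow> 'a set \<Rightarrow> ('g \<Rightarrow> 'a) topology" where
  "full_shift G A = product_topology (\<lambda>_. discrete_topology A) (carrier G)"

abbreviation configurations :: "('g, 'm) monoid_scheme \<Rightarrow> 'a set \<Rightarrow> ('g \<Rightarrow> 'a) set" where
  "configurations G A \<equiv> topspace (full_shift G A)"

definition shift :: "('g, 'm) monoid_scheme \<Rightarrow> 'g \<Rightarrow> ('g \<Rightarrow> 'a) \<Rightarrow> 'g \<Rightarrow> 'a" where
  "shift G g x = (\<lambda>h\<in>carrier G. x (inv\<^bsub>G\<^esub> g \<otimes>\<^bsub>G\<^esub> h))"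

definition subshift :: "('g, 'm) monoid_scheme \<Rightarrow> 'a set \<Rightarrow> ('g \<Rightarrow> 'a) set \<Rightarrow> bool" where
  "subshift G A X \<longleftrightarrow>
     closedin (full_shift G A) X \<and> (\<forall>g\<in>carrier G. shift G g ` X \<subseteq> X)"

definition cylinder :: "('g, 'm) monoid_scheme \<Rightarrow> 'a set \<Rightarrow> 'g \<Rightarrow> 'a \<Rightarrow> ('g \<Rightarrow> 'a) set" where
  "cylinder G A g a = {x \<in> configurations G A. x g = a}"

section \<open>Pattern codings\<close>

type_synonym ('g, 'a) pattern_coding = "('g list \<times> 'a) set"

definition pattern_codings :: "'g set \<Rightarrow> 'a set \<Rightarrow> ('g, 'a) pattern_coding set" where
  "pattern_codings S A = {c. finite c \<and> c \<subseteq> lists S \<times> A}"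

text \<open>
  The outer intersections with the space of configurations give empty intersections their intended
  value \<open>A\<^sup>G\<close>.
\<close>

definition defined_set :: "('g, 'm) monoid_scheme \<Rightarrow> 'a set \<Rightarrow>
    ('g, 'a) pattern_coding set \<Rightarrow> ('g \<Rightarrow> 'a) set" where
  "defined_set G A C = configurations G A \<inter>
     (\<Inter>g\<in>carrier G. \<Inter>c\<in>C. configurations G A -
        (configurations G A \<inter> (\<Inter>(w, a)\<in>c. cylinder G A (g \<otimes>\<^bsub>G\<^esub> word_value G w) a)))"

definition codings_define :: "('g, 'm) monoid_scheme \<Rightarrow> 'g set \<Rightarrow> 'a set \<Rightarrow>
    ('g, 'a) pattern_coding set \<Rightarrow> ('g \<Rightarrow> 'a) set \<Rightarrow> bool" where
  "codings_define G S A C X \<longleftrightarrow> C \<subseteq> pattern_codings S A \<and> X = defined_set G A C"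

definition pattern_coding_code ::
  "('g \<Rightarrow> nat) \<Rightarrow> ('a \<Rightarrow> nat) \<Rightarrow> ('g, 'a) pattern_coding \<Rightarrow> nat" where
  "pattern_coding_code e d c = set_encode ((\<lambda>(w, a). prod_encode (word_code e w, d a)) ` c)"

definition re_pattern_codings ::
  "'g set \<Rightarrow> 'a set \<Rightarrow> ('g, 'a) pattern_coding set \<Rightarrow> bool" where
  "re_pattern_codings S A C \<longleftrightarrow>
     (\<exists>e d. inj_on e S \<and> inj_on d A \<and> recursively_enumerable (pattern_coding_code e d ` C))"

definition effectively_closed ::
  "('g, 'm) monoid_scheme \<Rightarrow> 'g set \<Rightarrow> 'a set \<Rightarrow> ('g \<Rightarrow> 'a) set \<Rightarrow> bool" where
  "effectively_closed G S A X \<longleftrightarrow> (\<exists>C. re_pattern_codings S A C \<and> codings_define G S A C X)"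

end

theory Submission
  imports Defs
begin

text \<open>
  Let \<open>C\<close> be a recursively enumerable set of codings that defines \<open>X\<close>. As \<open>X\<close> is shift-invariant, a
  coding may be added to a defining set of \<open>X\<close> exactly if no configuration of \<open>X\<close> shows it at the
  identity. The set of all such codings (\<open>avoided_codings\<close>) therefore contains every defining set of
  \<open>X\<close>, and it defines \<open>X\<close> itself. So it is the greatest defining set, and what has to be shown is
  that it is recursively enumerable.

  A coding \<open>p\<close> is avoided iff there is no labeling of the words over \<open>S\<close> by letters of \<open>A\<close> that
  extends \<open>p\<close>, gives the same letter to words with the same value in \<open>G\<close>, and shows no translate of
  a coding in \<open>C\<close>. Such impossibility is witnessed by a finite refutation: \<open>p\<close> is refuted at once if
  it gives two letters to words that are equal in \<open>G\<close>, or if it contains a translate of a coding in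
  \<open>C\<close>; and \<open>p\<close> is refuted if for some word \<open>w\<close> all extensions of \<open>p\<close> by a letter at \<open>w\<close> are refuted.
  Completeness of these rules (\<open>refutable_complete\<close>) takes the place of a compactness argument: a
  coding that is not refutable can be extended by one word after the other without becoming
  refutable, and in the limit this gives a labeling.

  A set generated by finitely many rules with finitely many premises is recursively enumerable as
  soon as the rules are, because the derivations can be enumerated (\<open>semidecidable_derivable\<close>). This
  is used twice: for refutations, and for equality of words in \<open>G\<close>, which is generated by the
  deletion of relators of the presentation. The presentation may use another generating set; each
  letter of \<open>S\<close> is then replaced by a word over the generators of the presentation.

  The notion of recursive function is carried over from natural numbers to pairs and lists by
  standard numberings, so that the two rule systems can be shown recursively enumerable as they
  stand, by following the structure of the formulas.
\<close>

section \<open>Recursive functions up to extensionality\<close>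

text \<open>
  A recursive function is given by a function on all lists, but only its values on lists of the
  right length count. The predicate below forgets the other values, so that it can be transferred
  along equations that hold for the right length only.
\<close>

definition recursive_on :: "nat \<Rightarrow> (nat list \<Rightarrow> nat) \<Rightarrow> bool" where
  "recursive_on k f \<longleftrightarrow> (\<exists>F. recursive_fn k F \<and> (\<forall>xs. length xs = k \<longrightarrow> F xs = f xs))"

lemma recursive_on_cong:
  assumes "recursive_on k f" "\<And>xs. length xs = k \<Longrightarrow> f xs = g xs"
  shows "recursive_on k g"
  using assms unfolding recursive_on_def by auto

lemma recursive_on_nth: "i < k \<Longrightarrow> recursive_on k (\<lambda>xs. xs ! i)"
  unfolding recursive_on_def using recursive_fn.proj by blast

lemma recursive_on_comp:
  assumes "recursive_on (length fs) g" "\<forall>f\<in>set fs. recursive_on k f"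
  shows "recursive_on k (\<lambda>xs. g (map (\<lambda>f. f xs) fs))"
proof -
  obtain Gf where G: "recursive_fn (length fs) Gf" "\<And>xs. length xs = length fs \<Longrightarrow> Gf xs = g xs"
    using assms(1) unfolding recursive_on_def by auto
  obtain h where h: "\<And>f. f \<in> set fs \<Longrightarrow> recursive_fn k (h f)"
    "\<And>f xs. f \<in> set fs \<Longrightarrow> length xs = k \<Longrightarrow> h f xs = f xs"
    using assms(2) unfolding recursive_on_def by metis
  have "recursive_fn k (\<lambda>xs. Gf (map (\<lambda>f. f xs) (map h fs)))"
    using G(1) h(1) by (intro recursive_fn.comp) auto
  moreover have "Gf (map (\<lambda>f. f xs) (map h fs)) = g (map (\<lambda>f. f xs) fs)"
    if "length xs = k" for xs
  proof -
    have eq: "map (\<lambda>f. f xs) (map h fs) = map (\<lambda>f. f xs) fs"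
      using h(2) that by simp
    show ?thesis unfolding eq by (simp add: G(2))
  qed
  ultimately show ?thesis unfolding recursive_on_def by blast
qed

lemma recursive_on_comp1:
  assumes "recursive_on 1 (\<lambda>xs. g (xs ! 0))" "recursive_on k f"
  shows "recursive_on k (\<lambda>xs. g (f xs))"
  using recursive_on_comp[of "[f]" "\<lambda>xs. g (xs ! 0)" k] assms by simp

lemma recursive_on_comp2:
  assumes "recursive_on 2 (\<lambda>xs. g (xs ! 0) (xs ! 1))" "recursive_on k f1" "recursive_on k f2"
  shows "recursive_on k (\<lambda>xs. g (f1 xs) (f2 xs))"
  using recursive_on_comp[of "[f1, f2]" "\<lambda>xs. g (xs ! 0) (xs ! 1)" k] assms
  by (simp add: numeral_2_eq_2)

lemma recursive_on_zero: "recursive_on k (\<lambda>xs. 0)"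
  using recursive_on_comp[of "[]" "\<lambda>_. 0" k] recursive_fn.zero
  unfolding recursive_on_def by auto

lemma recursive_on_Suc: "recursive_on k f \<Longrightarrow> recursive_on k (\<lambda>xs. Suc (f xs))"
proof (rule recursive_on_comp1[where g = Suc])
  show "recursive_on 1 (\<lambda>xs. Suc (xs ! 0))"
    unfolding recursive_on_def
    using recursive_fn.succ by (intro exI[of _ "\<lambda>xs. Suc (hd xs)"]) (auto simp: length_Suc_conv)
qed

lemma recursive_on_const: "recursive_on k (\<lambda>xs. n)"
  by (induction n) (auto intro: recursive_on_zero recursive_on_Suc)

lemma recursive_on_prim_rec:
  assumes "recursive_on k f" "recursive_on (Suc (Suc k)) g"
  shows "recursive_on (Suc k) (\<lambda>xs. rec_nat (f (tl xs)) (\<lambda>n y. g (n # y # tl xs)) (hd xs))"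
proof -
  obtain F where F: "recursive_fn k F" "\<And>xs. length xs = k \<Longrightarrow> F xs = f xs"
    using assms(1) unfolding recursive_on_def by auto
  obtain Gf where G: "recursive_fn (Suc (Suc k)) Gf"
    "\<And>xs. length xs = Suc (Suc k) \<Longrightarrow> Gf xs = g xs"
    using assms(2) unfolding recursive_on_def by auto
  have "rec_nat (F (tl xs)) (\<lambda>n y. Gf (n # y # tl xs)) m =
        rec_nat (f (tl xs)) (\<lambda>n y. g (n # y # tl xs)) m" if "length xs = Suc k" for xs m
    using that by (induction m) (simp_all add: F G)
  then show ?thesis
    unfolding recursive_on_def using recursive_fn.prim_rec[OF F(1) G(1)] by blast
qed

text \<open>
  Recursion over a number with one parameter is enough for everything that follows: the parameter
  may be a code of a pair or a list.
\<close>

lemma recursive_on_rec_nat: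
  assumes b: "recursive_on 1 (\<lambda>xs. b (xs ! 0))"
    and g: "recursive_on 3 (\<lambda>xs. g (xs ! 0) (xs ! 1) (xs ! 2))"
    and n: "recursive_on k n" and a: "recursive_on k a"
  shows "recursive_on k (\<lambda>xs. rec_nat (b (a xs)) (\<lambda>m y. g m y (a xs)) (n xs))"
proof -
  have "recursive_on (Suc 1) (\<lambda>xs. rec_nat (b (tl xs ! 0))
          (\<lambda>m y. g ((m # y # tl xs) ! 0) ((m # y # tl xs) ! 1) ((m # y # tl xs) ! 2)) (hd xs))"
    using recursive_on_prim_rec[OF b, of "\<lambda>xs. g (xs ! 0) (xs ! 1) (xs ! 2)"] g
    by (simp add: numeral_3_eq_3)
  then have "recursive_on 2 (\<lambda>xs. rec_nat (b (xs ! 1)) (\<lambda>m y. g m y (xs ! 1)) (xs ! 0))"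
    unfolding Suc_1 by (rule recursive_on_cong) (auto simp: length_Suc_conv numeral_2_eq_2)
  then show ?thesis
    by (rule recursive_on_comp2[where g = "\<lambda>n a. rec_nat (b a) (\<lambda>m y. g m y a) n"]) (fact n a)+
qed

lemma recursive_on_add: "recursive_on k f \<Longrightarrow> recursive_on k g \<Longrightarrow> recursive_on k (\<lambda>xs. f xs + g xs)"
proof -
  have "rec_nat n (\<lambda>m y. Suc y) m = n + m" for n m by (induction m) auto
  then show "recursive_on k f \<Longrightarrow> recursive_on k g \<Longrightarrow> recursive_on k (\<lambda>xs. f xs + g xs)"
    using recursive_on_rec_nat[of "\<lambda>n. n" "\<lambda>m y a. Suc y" k g f]
    by (simp add: recursive_on_nth recursive_on_Suc)
qed

lemma recursive_on_pred: "recursive_on k f \<Longrightarrow> recursive_on k (\<lambda>xs. f xs - 1)"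
proof -
  have "rec_nat 0 (\<lambda>m y. m) n = n - 1" for n by (cases n) auto
  then show "recursive_on k f \<Longrightarrow> recursive_on k (\<lambda>xs. f xs - 1)"
    using recursive_on_rec_nat[of "\<lambda>n. 0" "\<lambda>m y a. m" k f f]
    by (simp add: recursive_on_nth recursive_on_zero)
qed

lemma recursive_on_diff:
  "recursive_on k f \<Longrightarrow> recursive_on k g \<Longrightarrow> recursive_on k (\<lambda>xs. f xs - g xs)"
proof -
  have "rec_nat n (\<lambda>m y. y - 1) m = n - m" for n m :: nat by (induction m) auto
  then show "recursive_on k f \<Longrightarrow> recursive_on k g \<Longrightarrow> recursive_on k (\<lambda>xs. f xs - g xs)"
    using recursive_on_rec_nat[of "\<lambda>n. n" "\<lambda>m y a. y - 1" k g f]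
      recursive_on_pred[of 3 "\<lambda>xs. xs ! 1"]
    by (simp add: recursive_on_nth)
qed

lemma recursive_on_triangle: "recursive_on k f \<Longrightarrow> recursive_on k (\<lambda>xs. triangle (f xs))"
proof -
  have "rec_nat 0 (\<lambda>m y. y + Suc m) n = triangle n" for n by (induction n) auto
  moreover have "recursive_on 3 (\<lambda>xs. xs ! 1 + Suc (xs ! 0))"
    by (intro recursive_on_add recursive_on_Suc recursive_on_nth) auto
  ultimately show "recursive_on k f \<Longrightarrow> recursive_on k (\<lambda>xs. triangle (f xs))"
    using recursive_on_rec_nat[of "\<lambda>n. 0" "\<lambda>m y a. y + Suc m" k f f]
    by (simp add: recursive_on_zero)
qed

lemma recursive_on_pair:
  "recursive_on k f \<Longrightarrow> recursive_on k g \<Longrightarrow> recursive_on k (\<lambda>xs. prod_encode (f xs, g xs))"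
  unfolding prod_encode_def prod.case
  by (intro recursive_on_add recursive_on_triangle)

text \<open>The pair coded by \<open>n\<close> lies on the diagonal whose index is the least \<open>s\<close> with
  \<open>n < triangle (s + 1)\<close>; the search for \<open>s\<close> is the only use of minimisation.\<close>

lemma recursive_on_unpair:
  assumes f: "recursive_on k f"
  shows "recursive_on k (\<lambda>xs. fst (prod_decode (f xs)))"
    and "recursive_on k (\<lambda>xs. snd (prod_decode (f xs)))"
proof -
  define s where "s n = (LEAST s. Suc n - triangle (Suc s) = 0)" for n
  have ex: "\<exists>s. Suc n - triangle (Suc s) = 0" for n
    by (rule exI[of _ n]) simp
  have s_eq: "s (prod_encode (a, b)) = a + b" for a b
    unfolding s_def
  proof (rule Least_equality)
    show "Suc (prod_encode (a, b)) - triangle (Suc (a + b)) = 0"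
      by (simp add: prod_encode_def)
  next
    fix t assume t: "Suc (prod_encode (a, b)) - triangle (Suc t) = 0"
    show "a + b \<le> t"
    proof (rule ccontr)
      assume "\<not> a + b \<le> t"
      then have "Suc t \<le> a + b" by simp
      then have "triangle (Suc t) \<le> triangle (a + b)"
        by (intro monoD[of triangle]) (simp_all add: mono_iff_le_Suc)
      then show False using t by (simp add: prod_encode_def)
    qed
  qed
  have s: "recursive_on k (\<lambda>xs. s (f xs))" if f: "recursive_on k f" for k f
  proof (rule recursive_on_comp1[where g = s, OF _ f])
    have "recursive_on (Suc 1) (\<lambda>xs. Suc (xs ! 1) - triangle (Suc (xs ! 0)))"
      by (intro recursive_on_diff recursive_on_Suc recursive_on_triangle recursive_on_nth) auto
    then obtain F where F: "recursive_fn (Suc 1) F"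
      "\<And>xs. length xs = Suc 1 \<Longrightarrow> F xs = Suc (xs ! 1) - triangle (Suc (xs ! 0))"
      unfolding recursive_on_def by auto
    have Fe: "F (n # xs) = Suc (xs ! 0) - triangle (Suc n)" if "length xs = 1" for n xs
      using F(2)[of "n # xs"] that by simp
    have "recursive_fn 1 (\<lambda>xs. LEAST n. F (n # xs) = 0)"
      using F(1) ex by (intro recursive_fn.minimise) (auto simp del: triangle_Suc simp: Fe)
    then show "recursive_on 1 (\<lambda>xs. s (xs ! 0))"
      unfolding recursive_on_def s_def using Fe by (intro exI conjI) auto
  qed
  have decode: "fst (prod_decode n) = n - triangle (s n)" "snd (prod_decode n) = s n - (n - triangle (s n))" for n
  proof -
    obtain a b where n: "n = prod_encode (a, b)" by (metis prod_decode_inverse surj_pair)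
    have "n - triangle (s n) = a" unfolding n s_eq by (simp add: prod_encode_def)
    then show "fst (prod_decode n) = n - triangle (s n)" "snd (prod_decode n) = s n - (n - triangle (s n))"
      using s_eq[of a b] by (simp_all add: n)
  qed
  show "recursive_on k (\<lambda>xs. fst (prod_decode (f xs)))"
    "recursive_on k (\<lambda>xs. snd (prod_decode (f xs)))"
    unfolding decode by (intro recursive_on_diff recursive_on_triangle s f)+
qed

section \<open>Computable functions on coded types\<close>

text \<open>
  Two classes, because a search over all values of a type needs every number to be a code, while
  truth values, over which no search is needed, have an injective code that is not surjective.
\<close>

class coded =
  fixes code :: "'a \<Rightarrow> nat"
  assumes inj_code: "inj code"

class numbered = coded +
  assumes surj_code: "surj code"

lemma code_eq_iff [simp]: "code x = code y \<longleftrightarrow> x = y"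
  using inj_code by (auto dest: injD)

instantiation nat :: numbered
begin
definition code_nat_def [simp]: "code (n :: nat) = n"
instance by standard (auto simp: inj_def)
end

instantiation bool :: coded
begin
definition code_bool_def: "code (b :: bool) = of_bool b"
instance by standard (auto simp: inj_def code_bool_def)
end

instantiation prod :: (coded, coded) coded
begin
definition code_prod_def: "code p = prod_encode (code (fst p), code (snd p))"
instance by standard (auto simp: inj_def code_prod_def prod_eq_iff)
end

instance prod :: (numbered, numbered) numbered
proof
  have "\<exists>p :: 'a \<times> 'b. n = code p" for n
  proof -
    obtain a b where n: "n = prod_encode (a, b)" by (metis prod_decode_inverse surj_pair)
    obtain x :: 'a and y :: 'b where "a = code x" "b = code y" using surj_code by (meson surjD)
    then show ?thesis using n by (intro exI[of _ "(x, y)"]) (simp add: code_prod_def)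
  qed
  then show "surj (code :: 'a \<times> 'b \<Rightarrow> nat)" by (simp add: surj_def)
qed

instantiation list :: (coded) coded
begin
definition code_list_def: "code l = list_encode (map code l)"
instance
  by standard (auto intro!: injI dest!: map_injective simp: code_list_def list_encode_eq inj_code)
end

instance list :: (numbered) numbered
proof
  have "surj (map (code :: 'a \<Rightarrow> nat))"
    using surj_code unfolding surj_def ex_map_conv by blast
  then have "surj (list_encode \<circ> map (code :: 'a \<Rightarrow> nat))"
    using surj_list_encode by (rule comp_surj)
  then show "surj (code :: 'a list \<Rightarrow> nat)" by (simp add: code_list_def[abs_def] comp_def)
qed

lemma code_Nil [simp]: "code [] = 0"
  and code_Cons: "code (x # l) = Suc (prod_encode (code x, code l))"
  by (simp_all add: code_list_def)

lemma code_Pair: "code (x, y) = prod_encode (code x, code y)"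
  by (simp add: code_prod_def)

text \<open>
  The function \<^term>\<open>F\<close> is not required to be determined by \<^term>\<open>f\<close>: numbers that are not
  codes may be sent anywhere.
\<close>

definition computable :: "('a :: coded \<Rightarrow> 'b :: coded) \<Rightarrow> bool" where
  "computable f \<longleftrightarrow> (\<exists>F. recursive_on 1 (\<lambda>xs. F (xs ! 0)) \<and> (\<forall>x. F (code x) = code (f x)))"

named_theorems computable_intros

lemma computableI:
  "recursive_on 1 (\<lambda>xs. F (xs ! 0)) \<Longrightarrow> (\<And>x. F (code x) = code (f x)) \<Longrightarrow> computable f"
  unfolding computable_def by blast

lemma computable_id [computable_intros]: "computable (\<lambda>x. x)"
  by (rule computableI[where F = "\<lambda>n. n"]) (simp_all add: recursive_on_nth)

lemma computable_const [computable_intros]: "computable (\<lambda>x. c)"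
  by (rule computableI[where F = "\<lambda>n. code c"]) (simp_all add: recursive_on_const)

lemma computable_comp:
  assumes "computable f" "computable g"
  shows "computable (\<lambda>x. f (g x))"
proof -
  obtain F H where F: "recursive_on 1 (\<lambda>xs. F (xs ! 0))" "\<And>x. F (code x) = code (f x)"
    and H: "recursive_on 1 (\<lambda>xs. H (xs ! 0))" "\<And>x. H (code x) = code (g x)"
    using assms unfolding computable_def by metis
  show ?thesis
    by (rule computableI[where F = "\<lambda>n. F (H n)"])
      (simp_all add: recursive_on_comp1[OF F(1) H(1)] F(2) H(2) del: One_nat_def)
qed

lemma computable_Pair [computable_intros]:
  assumes "computable f" "computable g"
  shows "computable (\<lambda>x. (f x, g x))"
proof -
  obtain F H where F: "recursive_on 1 (\<lambda>xs. F (xs ! 0))" "\<And>x. F (code x) = code (f x)"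
    and H: "recursive_on 1 (\<lambda>xs. H (xs ! 0))" "\<And>x. H (code x) = code (g x)"
    using assms unfolding computable_def by metis
  show ?thesis
    by (rule computableI[where F = "\<lambda>n. prod_encode (F n, H n)"])
      (simp_all add: recursive_on_pair[OF F(1) H(1)] F(2) H(2) code_Pair del: One_nat_def)
qed

lemma computable_fst [computable_intros]: "computable f \<Longrightarrow> computable (\<lambda>x. fst (f x))"
  and computable_snd [computable_intros]: "computable f \<Longrightarrow> computable (\<lambda>x. snd (f x))"
proof -
  have "computable (fst :: 'b \<times> 'c \<Rightarrow> 'b)"
    by (rule computableI[where F = "\<lambda>n. fst (prod_decode n)"])
      (simp_all add: recursive_on_unpair recursive_on_nth code_prod_def)
  then show "computable f \<Longrightarrow> computable (\<lambda>x. fst (f x))" by (rule computable_comp)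
  have "computable (snd :: 'b \<times> 'c \<Rightarrow> 'c)"
    by (rule computableI[where F = "\<lambda>n. snd (prod_decode n)"])
      (simp_all add: recursive_on_unpair recursive_on_nth code_prod_def)
  then show "computable f \<Longrightarrow> computable (\<lambda>x. snd (f x))" by (rule computable_comp)
qed

lemma computable_rec_nat [computable_intros]:
  assumes n: "computable n" and b: "computable b"
    and g: "computable (\<lambda>p. g (fst p) (fst (snd p)) (snd (snd p)))"
  shows "computable (\<lambda>x. rec_nat (b x) (\<lambda>m y. g m y x) (n x))"
proof -
  obtain N B H where N: "recursive_on 1 (\<lambda>xs. N (xs ! 0))" "\<And>x. N (code x) = n x"
    and B: "recursive_on 1 (\<lambda>xs. B (xs ! 0))" "\<And>x. B (code x) = code (b x)"
    and H: "recursive_on 1 (\<lambda>xs. H (xs ! 0))"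
      "\<And>p. H (code p) = code (g (fst p) (fst (snd p)) (snd (snd p)))"
    using n b g unfolding computable_def code_nat_def by metis
  have H': "recursive_on 3 (\<lambda>xs. H (prod_encode (xs ! 0, prod_encode (xs ! 1, xs ! 2))))"
    by (intro recursive_on_comp1[OF H(1)] recursive_on_pair recursive_on_nth) simp_all
  have H_eq: "H (prod_encode (m, prod_encode (code y, code x))) = code (g m y x)" for m y x
    using H(2)[of "(m, y, x)"] by (simp add: code_Pair)
  have "rec_nat (B (code x)) (\<lambda>m y. H (prod_encode (m, prod_encode (y, code x)))) k =
      code (rec_nat (b x) (\<lambda>m y. g m y x) k)" for x k
    by (induction k) (simp_all add: B(2) H_eq)
  then show ?thesis
    by (intro computableI[OF recursive_on_rec_nat[OF B(1) H' N(1) recursive_on_nth]])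
      (simp_all add: N(2))
qed

text \<open>Computability of the constructions on natural numbers, Booleans and lists is stated in applied
  form, so that a goal is solved by resolving with these rules along the structure of the term.\<close>

lemma computable_Suc [computable_intros]: "computable f \<Longrightarrow> computable (\<lambda>x. Suc (f x))"
  by (rule computable_comp[of Suc], rule computableI[where F = Suc])
    (simp_all add: recursive_on_Suc recursive_on_nth)

lemma computable_by_code:
  fixes F :: "nat \<Rightarrow> nat"
  assumes "computable F" "\<And>x. F (code x) = code (f x)"
  shows "computable f"
  using assms unfolding computable_def code_nat_def by auto

lemma computable_code [computable_intros]: "computable f \<Longrightarrow> computable (\<lambda>x. code (f x))"
  unfolding computable_def by simp

lemma computable_of_bool [computable_intros]:
  "computable P \<Longrightarrow> computable (\<lambda>x. of_bool (P x) :: nat)"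
  unfolding computable_def code_bool_def by simp

lemma computable_add [computable_intros]:
  fixes f g :: "_ \<Rightarrow> nat"
  assumes "computable f" "computable g"
  shows "computable (\<lambda>x. f x + g x)"
proof -
  have "rec_nat n (\<lambda>m y. Suc y) m = n + m" for n m by (induction m) auto
  moreover have "computable (\<lambda>x. rec_nat (f x) (\<lambda>m y. Suc y) (g x))"
    by (intro computable_intros assms)
  ultimately show ?thesis by simp
qed

lemma computable_diff [computable_intros]:
  fixes f g :: "_ \<Rightarrow> nat"
  assumes "computable f" "computable g"
  shows "computable (\<lambda>x. f x - g x)"
proof -
  have "computable (\<lambda>p :: nat \<times> nat. fst p - snd p)"
    by (rule computableI[where F = "\<lambda>n. fst (prod_decode n) - snd (prod_decode n)"])
      (simp_all add: recursive_on_diff recursive_on_unpair recursive_on_nth code_prod_def)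
  from computable_comp[OF this computable_Pair[OF assms]] show ?thesis by simp
qed

lemma computable_If [computable_intros]:
  assumes "computable P" "computable f" "computable g"
  shows "computable (\<lambda>x. if P x then f x else g x)"
proof -
  have "computable (\<lambda>x. rec_nat (g x) (\<lambda>m y. f x) (of_bool (P x)))"
    by (intro computable_intros assms computable_comp[OF assms(2)])
  moreover have "rec_nat (g x) (\<lambda>m y. f x) (of_bool (P x)) = (if P x then f x else g x)" for x
    by simp
  ultimately show ?thesis by simp
qed

lemma computable_eq_0: "computable f \<Longrightarrow> computable (\<lambda>x. f x = (0 :: nat))"
proof (rule computable_comp[where f = "\<lambda>n. n = 0"])
  have "computable (\<lambda>n :: nat. 1 - n)" by (intro computable_intros)
  then show "computable (\<lambda>n :: nat. n = 0)"
    by (rule computable_by_code) (simp add: code_bool_def)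
qed

lemma computable_eq [computable_intros]:
  assumes "computable f" "computable g"
  shows "computable (\<lambda>x. f x = g x)"
proof -
  have "computable (\<lambda>x. (code (f x) - code (g x)) + (code (g x) - code (f x)) = 0)"
    by (intro computable_eq_0 computable_intros assms)
  moreover have "(code a - code b) + (code b - code a) = 0 \<longleftrightarrow> a = b" for a b :: 'b
    using code_eq_iff[of a b] by (simp del: code_eq_iff) linarith
  ultimately show ?thesis by simp
qed

lemma computable_not [computable_intros]: "computable P \<Longrightarrow> computable (\<lambda>x. \<not> P x)"
proof -
  assume "computable P"
  then have "computable (\<lambda>x. if P x then False else True)" by (intro computable_intros)
  moreover have "(if p then False else True) = (\<not> p)" for p by simp
  ultimately show ?thesis by (simp only:)
qed

lemma computable_conj [computable_intros]:
  "computable P \<Longrightarrow> computable Q \<Longrightarrow> computable (\<lambda>x. P x \<and> Q x)"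
proof -
  assume "computable P" "computable Q"
  then have "computable (\<lambda>x. if P x then Q x else False)" by (intro computable_intros)
  moreover have "(if p then q else False) = (p \<and> q)" for p q by simp
  ultimately show ?thesis by (simp only:)
qed

lemma computable_disj [computable_intros]:
  "computable P \<Longrightarrow> computable Q \<Longrightarrow> computable (\<lambda>x. P x \<or> Q x)"
  using computable_not[OF computable_conj[OF computable_not computable_not], of P Q] by simp

lemma computable_Cons [computable_intros]:
  assumes "computable f" "computable l"
  shows "computable (\<lambda>x. f x # l x)"
proof -
  obtain F L where F: "recursive_on 1 (\<lambda>xs. F (xs ! 0))" "\<And>x. F (code x) = code (f x)"
    and L: "recursive_on 1 (\<lambda>xs. L (xs ! 0))" "\<And>x. L (code x) = code (l x)"
    using assms unfolding computable_def by metis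
  show ?thesis
    by (rule computableI[where F = "\<lambda>n. Suc (prod_encode (F n, L n))"])
      (simp_all add: recursive_on_Suc[OF recursive_on_pair[OF F(1) L(1)]] F(2) L(2) code_Cons
        del: One_nat_def)
qed

lemma computable_prod_decode [computable_intros]:
  "computable f \<Longrightarrow> computable (\<lambda>x. prod_decode (f x))"
  by (rule computable_comp[of prod_decode], rule computableI[where F = "\<lambda>n. n"])
    (simp_all add: recursive_on_nth code_prod_def)

lemma computable_hd [computable_intros]: "computable l \<Longrightarrow> computable (\<lambda>x. hd (l x))"
proof (rule computable_comp[of hd])
  \<comment> \<open>The unspecified head of the empty list is some fixed value, and constants are computable.\<close>
  have "computable (\<lambda>n. if n = 0 then code (hd [] :: 'b) else fst (prod_decode (n - 1)))"
    by (intro computable_intros)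
  then show "computable (hd :: 'b list \<Rightarrow> 'b)"
  proof (rule computable_by_code)
    fix l :: "'b list"
    show "(if code l = 0 then code (hd [] :: 'b) else fst (prod_decode (code l - 1))) = code (hd l)"
      by (cases l) (simp_all add: code_Cons)
  qed
qed

lemma computable_tl [computable_intros]: "computable l \<Longrightarrow> computable (\<lambda>x. tl (l x))"
proof (rule computable_comp[of tl])
  have "computable (\<lambda>n. if n = 0 then 0 else snd (prod_decode (n - 1)))"
    by (intro computable_intros)
  then show "computable (tl :: 'b list \<Rightarrow> 'b list)"
  proof (rule computable_by_code)
    fix l :: "'b list"
    show "(if code l = 0 then 0 else snd (prod_decode (code l - 1))) = code (tl l)"
      by (cases l) (simp_all add: code_Cons)
  qed
qed

lemma length_le_code: "length l \<le> code l"
proof (induction l)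
  case (Cons a l)
  then show ?case using le_prod_encode_2[of "code l" "code a"] by (simp add: code_Cons)
qed simp

text \<open>
  A fold consumes its list from the left, so it is an iteration of a step function on pairs of the
  remaining list and the accumulator. The step does nothing on the empty list; hence the number of
  iterations may be any bound on the length, and the code of the list is one.
\<close>

lemma computable_fold [computable_intros]:
  assumes l: "computable l" and i: "computable i"
    and g: "computable (\<lambda>p. g (fst p) (fst (snd p)) (snd (snd p)))"
  shows "computable (\<lambda>x. fold (\<lambda>a acc. g a acc x) (l x) (i x))"
proof -
  define step where "step x s =
    (if fst s = [] then s else (tl (fst s), g (hd (fst s)) (snd s) x))" for x s
  have step: "computable (\<lambda>p. step (snd p) (fst p))"
    unfolding step_def
    by (intro computable_intros computable_comp[OF g, of "\<lambda>p. (hd (fst (fst p)), snd (fst p), snd p)", simplified])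
  have "computable (\<lambda>x. snd (rec_nat (l x, i x) (\<lambda>m s. step x s) (code (l x))))"
    by (intro computable_intros l i computable_comp[OF step, of "\<lambda>p. (fst (snd p), snd (snd p))", simplified])
  moreover have main: "snd (rec_nat (l, i) (\<lambda>m s. step x s) n) = fold (\<lambda>a acc. g a acc x) l i"
    if "length l \<le> n" for n l i x
  proof -
    have funpow: "rec_nat s (\<lambda>m. h) n = (h ^^ n) s" for h :: "'b list \<times> 'c \<Rightarrow> _" and s n
      by (induction n) auto
    have nil: "(step x ^^ n) ([], i) = ([], i)" for n i
      by (induction n) (auto simp: step_def)
    show ?thesis
      unfolding funpow using that
    proof (induction l arbitrary: i n)
      case Nil
      then show ?case by (simp add: nil)
    next
      case (Cons a l)
      then obtain k where "n = Suc k" "length l \<le> k" by (cases n) auto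
      then show ?case using Cons.IH[of k "g a i x"] by (simp add: funpow_Suc_right step_def del: funpow.simps)
    qed
  qed
  ultimately show ?thesis by (simp only: main[OF length_le_code])
qed

lemma computable_rev [computable_intros]: "computable l \<Longrightarrow> computable (\<lambda>x. rev (l x))"
  unfolding rev_conv_fold by (intro computable_intros)

lemma computable_append [computable_intros]:
  "computable l \<Longrightarrow> computable l' \<Longrightarrow> computable (\<lambda>x. l x @ l' x)"
proof -
  have eq: "a @ b = fold (\<lambda>x acc. x # acc) (rev a) b" for a b :: "'b list"
    by (induction a) auto
  show "computable l \<Longrightarrow> computable l' \<Longrightarrow> computable (\<lambda>x. l x @ l' x)"
    unfolding eq by (intro computable_intros)
qed

lemma computable_concat_map [computable_intros]:
  assumes "computable l" "computable (\<lambda>p. f (fst p) (snd p))"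
  shows "computable (\<lambda>x. concat (map (\<lambda>a. f a x) (l x)))"
proof -
  have eq: "fold (\<lambda>a acc. acc @ h a) l ys = ys @ concat (map h l)"
    for h :: "'b \<Rightarrow> 'c list" and l ys
    by (induction l arbitrary: ys) auto
  have "computable (\<lambda>x. fold (\<lambda>a acc. acc @ f a x) (l x) [])"
    by (intro computable_intros assms
        computable_comp[OF assms(2), of "\<lambda>p. (fst p, snd (snd p))", simplified])
  then show ?thesis by (simp add: eq)
qed

lemma computable_map [computable_intros]:
  assumes "computable l" "computable (\<lambda>p. f (fst p) (snd p))"
  shows "computable (\<lambda>x. map (\<lambda>a. f a x) (l x))"
proof -
  have "computable (\<lambda>x. concat (map (\<lambda>a. [f a x]) (l x)))"
    by (intro computable_intros assms)
  moreover have "concat (map (\<lambda>a. [h a]) l) = map h l" for h :: "'b \<Rightarrow> 'c" and l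
    by (induction l) auto
  ultimately show ?thesis by simp
qed

lemma computable_Ball_set [computable_intros]:
  assumes "computable l" "computable (\<lambda>p. P (fst p) (snd p))"
  shows "computable (\<lambda>x. \<forall>a\<in>set (l x). P a x)"
proof -
  have eq: "fold (\<lambda>a acc. acc \<and> h a) l b \<longleftrightarrow> b \<and> (\<forall>a\<in>set l. h a)" for h :: "'b \<Rightarrow> bool" and l b
    by (induction l arbitrary: b) auto
  have "computable (\<lambda>x. fold (\<lambda>a acc. acc \<and> P a x) (l x) True)"
    by (intro computable_intros assms
        computable_comp[OF assms(2), of "\<lambda>p. (fst p, snd (snd p))", simplified])
  then show ?thesis by (simp add: eq)
qed

lemma computable_mem_set [computable_intros]:
  assumes "computable f" "computable l"
  shows "computable (\<lambda>x. f x \<in> set (l x))"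
proof -
  have "computable (\<lambda>x. \<not> (\<forall>a\<in>set (l x). a \<noteq> f x))"
    by (intro computable_intros assms computable_comp[OF assms(1)])
  moreover have "\<not> (\<forall>a\<in>set l. a \<noteq> b) \<longleftrightarrow> b \<in> set l" for b :: 'b and l by auto
  ultimately show ?thesis by simp
qed

lemma computable_finite_set:
  assumes "finite F" "computable f"
  shows "computable (\<lambda>x. f x \<in> F)"
proof -
  obtain l where "F = set l" using assms(1) finite_list by auto
  then show ?thesis using assms(2) by (simp add: computable_intros)
qed

lemma computable_distinct [computable_intros]:
  assumes "computable l"
  shows "computable (\<lambda>x. distinct (l x))"
proof -
  have eq: "fold (\<lambda>a s. (a # fst s, snd s \<and> a \<notin> set (fst s))) l s =
      (rev l @ fst s, snd s \<and> distinct l \<and> set l \<inter> set (fst s) = {})" for l :: "'b list" and s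
    by (induction l arbitrary: s) auto
  have "computable (\<lambda>x. snd (fold (\<lambda>a s. (a # fst s, snd s \<and> a \<notin> set (fst s))) (l x) ([], True)))"
    by (intro computable_intros assms)
  then show ?thesis by (simp add: eq)
qed

lemma computable_power_2 [computable_intros]:
  "computable f \<Longrightarrow> computable (\<lambda>x. 2 ^ f x :: nat)"
proof -
  have eq: "(2 :: nat) ^ n = rec_nat 1 (\<lambda>m y. y + y) n" for n :: nat by (induction n) auto
  show "computable f \<Longrightarrow> computable (\<lambda>x. 2 ^ f x :: nat)"
    unfolding eq by (intro computable_intros)
qed

text \<open>
  Finite tables are computable. This is the reason why the choice of a translation of the finitely
  many generators into words does not matter.
\<close>

lemma computable_extension_of_finite:
  assumes "finite F"
  obtains h where "computable h" "\<And>x. x \<in> F \<Longrightarrow> h x = t x"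
proof -
  have "\<exists>h. computable h \<and> (\<forall>x\<in>F. h x = t x)"
    using assms
  proof induction
    case empty
    show ?case using computable_const by blast
  next
    case (insert a F)
    then obtain h where "computable h" "\<forall>x\<in>F. h x = t x" by blast
    then have "computable (\<lambda>x. if x = a then t a else h x)"
      "\<forall>x\<in>insert a F. (if x = a then t a else h x) = t x"
      by (auto intro!: computable_intros)
    then show ?case by blast
  qed
  then show ?thesis using that by blast
qed

section \<open>Semidecidable predicates\<close>

definition semidecidable :: "('a :: coded \<Rightarrow> bool) \<Rightarrow> bool" where
  "semidecidable P \<longleftrightarrow>
     (\<exists>Q :: 'a \<times> nat \<Rightarrow> bool. computable Q \<and> (\<forall>x. P x \<longleftrightarrow> (\<exists>n. Q (x, n))))"

named_theorems semidecidable_intros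

lemma semidecidable_computable [semidecidable_intros]: "computable P \<Longrightarrow> semidecidable P"
  unfolding semidecidable_def
  by (rule exI[of _ "\<lambda>q. P (fst q)"])
    (auto intro!: computable_comp[where f = P] computable_intros)

lemma semidecidable_comp:
  assumes "semidecidable P" "computable f"
  shows "semidecidable (\<lambda>x. P (f x))"
proof -
  obtain Q where Q: "computable Q" "\<And>x. P x \<longleftrightarrow> (\<exists>n :: nat. Q (x, n))"
    using assms(1) unfolding semidecidable_def by blast
  have "computable (\<lambda>q. Q (f (fst q), snd q))"
    by (intro computable_comp[OF Q(1)] computable_comp[OF assms(2)] computable_intros)
  then show ?thesis
    unfolding semidecidable_def
    by (intro exI[of _ "\<lambda>q. Q (f (fst q), snd q)"]) (simp add: Q(2))
qed

lemma semidecidable_conj [semidecidable_intros]: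
  assumes "semidecidable P" "semidecidable P'"
  shows "semidecidable (\<lambda>x. P x \<and> P' x)"
proof -
  obtain Q Q' where Q: "computable Q" "\<And>x. P x \<longleftrightarrow> (\<exists>n :: nat. Q (x, n))"
    and Q': "computable Q'" "\<And>x. P' x \<longleftrightarrow> (\<exists>n :: nat. Q' (x, n))"
    using assms unfolding semidecidable_def by blast
  define W where "W q \<longleftrightarrow> Q (fst q, fst (prod_decode (snd q))) \<and> Q' (fst q, snd (prod_decode (snd q)))" for q
  have "computable W"
    unfolding W_def
    by (intro computable_conj computable_comp[OF Q(1)] computable_comp[OF Q'(1)] computable_intros)
  moreover have "(\<exists>n. Q (x, n)) \<and> (\<exists>n. Q' (x, n)) \<longleftrightarrow> (\<exists>n. W (x, n))" for x
    unfolding W_def by (metis fst_conv prod_encode_inverse snd_conv)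
  ultimately show ?thesis unfolding semidecidable_def Q(2) Q'(2) by blast
qed

lemma semidecidable_disj [semidecidable_intros]:
  assumes "semidecidable P" "semidecidable P'"
  shows "semidecidable (\<lambda>x. P x \<or> P' x)"
proof -
  obtain Q Q' where Q: "computable Q" "\<And>x. P x \<longleftrightarrow> (\<exists>n :: nat. Q (x, n))"
    and Q': "computable Q'" "\<And>x. P' x \<longleftrightarrow> (\<exists>n :: nat. Q' (x, n))"
    using assms unfolding semidecidable_def by blast
  have "computable (\<lambda>q. Q q \<or> Q' q)" by (intro computable_intros Q Q')
  then show ?thesis unfolding semidecidable_def
    by (intro exI[of _ "\<lambda>q. Q q \<or> Q' q"]) (auto simp: Q(2) Q'(2))
qed

text \<open>Existential quantifiers are absorbed into the search, as witness and search bound are coded by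
  one number.\<close>

lemma semidecidable_Ex [semidecidable_intros]:
  fixes P :: "'a :: coded \<Rightarrow> 'b :: numbered \<Rightarrow> bool"
  assumes "semidecidable (\<lambda>p. P (fst p) (snd p))"
  shows "semidecidable (\<lambda>x. \<exists>y. P x y)"
proof -
  obtain Q where Q: "computable Q" "\<And>x y. P x y \<longleftrightarrow> (\<exists>n :: nat. Q ((x, y), n))"
    using assms unfolding semidecidable_def by auto
  define decode where "decode = (inv_into UNIV code :: nat \<Rightarrow> 'b)"
  have decode: "computable decode"
    by (rule computableI[where F = "\<lambda>n. n"])
      (simp_all add: recursive_on_nth decode_def surj_f_inv_f surj_code)
  define W where "W q = Q ((fst q, decode (fst (prod_decode (snd q)))), snd (prod_decode (snd q)))" for q
  have "computable W"
    unfolding W_def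
    by (intro computable_comp[OF Q(1)] computable_Pair computable_comp[OF decode] computable_intros)
  moreover have "(\<exists>y. P x y) \<longleftrightarrow> (\<exists>n. W (x, n))" for x
  proof
    assume "\<exists>y. P x y"
    then obtain y n where "Q ((x, y), n)" using Q(2) by blast
    then have "W (x, prod_encode (code y, n))"
      by (simp add: W_def decode_def inj_code)
    then show "\<exists>n. W (x, n)" by blast
  qed (use Q(2) in \<open>auto simp: W_def\<close>)
  ultimately show ?thesis unfolding semidecidable_def by blast
qed

lemma semidecidable_image:
  fixes f :: "'a :: numbered \<Rightarrow> 'b :: coded"
  assumes "semidecidable (\<lambda>x. x \<in> N)" "computable f"
  shows "semidecidable (\<lambda>y. y \<in> f ` N)"
proof -
  have "semidecidable (\<lambda>y. \<exists>x. x \<in> N \<and> f x = y)"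
    by (intro semidecidable_intros semidecidable_comp[OF assms(1)] computable_comp[OF assms(2)]
        computable_intros)
  then show ?thesis by (simp add: image_iff Bex_def eq_commute)
qed

text \<open>
  From right to left, the enumeration runs through all pairs of an element and a number; pairs that
  are no witness are sent to a fixed element.
\<close>

lemma recursively_enumerable_iff_semidecidable:
  "recursively_enumerable N \<longleftrightarrow> semidecidable (\<lambda>n. n \<in> N)"
proof
  assume N: "recursively_enumerable N"
  show "semidecidable (\<lambda>n. n \<in> N)"
  proof (cases "N = {}")
    case True
    then show ?thesis by (simp add: semidecidable_intros computable_intros)
  next
    case False
    then obtain f where f: "recursive_fn 1 f" "N = range (\<lambda>n. f [n])"
      using N unfolding recursively_enumerable_def by blast
    have "recursive_on 1 (\<lambda>xs. f [xs ! 0])"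
      unfolding recursive_on_def using f(1) by (intro exI[of _ f]) (auto simp: length_Suc_conv)
    then have "computable (\<lambda>n. f [n])" by (rule computableI) simp
    then have "semidecidable (\<lambda>n. n \<in> (\<lambda>n. f [n]) ` UNIV)"
      by (intro semidecidable_image semidecidable_intros) (simp add: computable_const)
    then show ?thesis using f(2) by simp
  qed
next
  assume N: "semidecidable (\<lambda>n. n \<in> N)"
  show "recursively_enumerable N"
  proof (cases "N = {}")
    case False
    then obtain n0 where n0: "n0 \<in> N" by blast
    obtain Q where Q: "computable Q" "\<And>x. x \<in> N \<longleftrightarrow> (\<exists>n :: nat. Q (x, n))"
      using N unfolding semidecidable_def by blast
    define h where "h n = (if Q (prod_decode n) then fst (prod_decode n) else n0)" for n
    have "computable h"
      unfolding h_def by (intro computable_intros computable_comp[OF Q(1)])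
    then obtain F where "recursive_on 1 (\<lambda>xs. F (xs ! 0))" "\<And>n. F n = h n"
      unfolding computable_def by auto
    then obtain f where f: "recursive_fn 1 f" "\<And>n. f [n] = h n"
      unfolding recursive_on_def by auto
    have "N = range h"
    proof (intro subset_antisym subsetI)
      fix x assume "x \<in> N"
      then obtain n where "Q (x, n)" using Q(2) by blast
      then have "h (prod_encode (x, n)) = x" by (simp add: h_def)
      then show "x \<in> range h" by (metis rangeI)
    next
      fix x assume "x \<in> range h"
      then show "x \<in> N" using n0 Q(2) by (auto simp: h_def) (metis surjective_pairing)
    qed
    then show ?thesis unfolding recursively_enumerable_def using f by auto
  qed (simp add: recursively_enumerable_def)
qed

text \<open>
  A rule system relates a finite list of premises to a conclusion. A derivation is linearised as a
  list of rule instances, each with a witness that it is an instance, such that the premises of each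
  occur as conclusions further left; validity of such a list is computable.
\<close>

inductive derivable :: "('a list \<Rightarrow> 'a \<Rightarrow> bool) \<Rightarrow> 'a \<Rightarrow> bool"
  for R :: "'a list \<Rightarrow> 'a \<Rightarrow> bool" where
  derive_step: "R ps c \<Longrightarrow> \<forall>p\<in>set ps. derivable R p \<Longrightarrow> derivable R c"

text \<open>The second argument collects the conclusions that may be used as premises.\<close>

fun valid_proof :: "(('a list \<times> 'a) \<times> nat \<Rightarrow> bool) \<Rightarrow> 'a list \<Rightarrow> (('a list \<times> 'a) \<times> nat) list \<Rightarrow> bool" where
  "valid_proof Q seen [] \<longleftrightarrow> True"
| "valid_proof Q seen (e # es) \<longleftrightarrow>
     Q e \<and> (\<forall>p\<in>set (fst (fst e)). p \<in> set seen) \<and> valid_proof Q (snd (fst e) # seen) es"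

lemma valid_proof_append:
  "valid_proof Q seen (es @ es') \<longleftrightarrow>
     valid_proof Q seen es \<and> valid_proof Q (rev (map (snd \<circ> fst) es) @ seen) es'"
  by (induction es arbitrary: seen) auto

lemma valid_proof_mono:
  "valid_proof Q seen es \<Longrightarrow> set seen \<subseteq> set seen' \<Longrightarrow> valid_proof Q seen' es"
proof (induction es arbitrary: seen seen')
  case (Cons e es)
  then show ?case using Cons.IH[of "snd (fst e) # seen" "snd (fst e) # seen'"] by auto
qed simp

lemma semidecidable_derivable:
  fixes R :: "'a :: numbered list \<Rightarrow> 'a \<Rightarrow> bool"
  assumes "semidecidable (\<lambda>q. R (fst q) (snd q))"
  shows "semidecidable (derivable R)"
proof -
  obtain Q where Q: "computable Q" "\<And>ps c. R ps c \<longleftrightarrow> (\<exists>n :: nat. Q ((ps, c), n))"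
    using assms unfolding semidecidable_def by auto
  define concl where "concl = (\<lambda>es :: (('a list \<times> 'a) \<times> nat) list. map (snd \<circ> fst) es)"
  have sound: "derivable R c"
    if "valid_proof Q seen es" "\<forall>d\<in>set seen. derivable R d" "c \<in> set (concl es)" for seen es c
    using that
  proof (induction es arbitrary: seen)
    case (Cons e es)
    then have "Q ((fst (fst e), snd (fst e)), snd e)" by simp
    then have "R (fst (fst e)) (snd (fst e))" using Q(2) by blast
    then have "derivable R (snd (fst e))" using Cons.prems by (intro derive_step[of R "fst (fst e)"]) auto
    then show ?case using Cons.IH[of "snd (fst e) # seen"] Cons.prems by (auto simp: concl_def)
  qed (simp add: concl_def)
  \<comment> \<open>Proofs of several premises are put one after the other; the second stays valid when more premises are available.\<close>
  have collect: "\<exists>es. valid_proof Q [] es \<and> set ps \<subseteq> set (concl es)"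
    if "\<forall>p\<in>set ps. \<exists>es. valid_proof Q [] es \<and> p \<in> set (concl es)" for ps
    using that
  proof (induction ps)
    case Nil
    show ?case by (intro exI[of _ "[]"]) simp
  next
    case (Cons p ps)
    then obtain es es' where es: "valid_proof Q [] es" "set ps \<subseteq> set (concl es)"
      "valid_proof Q [] es'" "p \<in> set (concl es')" by auto
    then have "valid_proof Q [] (es @ es')"
      by (auto simp: valid_proof_append intro: valid_proof_mono)
    then show ?case using es by (intro exI[of _ "es @ es'"]) (auto simp: concl_def)
  qed
  have complete: "\<exists>es. valid_proof Q [] es \<and> c \<in> set (concl es)" if "derivable R c" for c
    using that
  proof induction
    case (derive_step ps c)
    then obtain es where es: "valid_proof Q [] es" "set ps \<subseteq> set (concl es)"
      using collect[of ps] by blast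
    obtain n where "Q ((ps, c), n)" using derive_step Q(2) by blast
    then have "valid_proof Q [] (es @ [((ps, c), n)])"
      using es by (auto simp: valid_proof_append concl_def)
    then show ?case by (intro exI[of _ "es @ [((ps, c), n)]"]) (simp add: concl_def)
  qed
  have iff: "derivable R = (\<lambda>c. \<exists>es. valid_proof Q [] es \<and> c \<in> set (concl es))"
    using sound[of "[]"] complete by auto
  have fold: "fold (\<lambda>e s. (snd (fst e) # fst s,
        snd s \<and> Q e \<and> (\<forall>p\<in>set (fst (fst e)). p \<in> set (fst s)))) es s =
      (rev (map (snd \<circ> fst) es) @ fst s, snd s \<and> valid_proof Q (fst s) es)" for es s
    by (induction es arbitrary: s) auto
  have "computable (\<lambda>es. snd (fold (\<lambda>e s. (snd (fst e) # fst s,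
        snd s \<and> Q e \<and> (\<forall>p\<in>set (fst (fst e)). p \<in> set (fst s)))) es ([], True)))"
    by (intro computable_intros computable_comp[OF Q(1)])
  then have valid: "computable (\<lambda>es. valid_proof Q [] es)"
    by (simp add: fold)
  have "semidecidable (\<lambda>c. \<exists>es. valid_proof Q [] es \<and> c \<in> set (concl es))"
    unfolding concl_def comp_def
    by (intro semidecidable_intros semidecidable_computable computable_comp[OF valid]
        computable_conj computable_intros)
  then show ?thesis unfolding iff .
qed

section \<open>The word problem of a recursively presented group\<close>

text \<open>
  Equality modulo relators, for words without formal inverses. If the alphabet is closed under
  inverses in the group, then these words suffice, provided that \<open>s s\<^sup>-\<^sup>1\<close> is added to the relators
  for each letter \<open>s\<close>.
\<close>

inductive word_cong :: "'l set \<Rightarrow> 'l list set \<Rightarrow> 'l list \<Rightarrow> 'l list \<Rightarrow> bool"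
  for L :: "'l set" and T :: "'l list set" where
  refl: "w \<in> lists L \<Longrightarrow> word_cong L T w w"
| sym: "word_cong L T u v \<Longrightarrow> word_cong L T v u"
| trans: "word_cong L T u v \<Longrightarrow> word_cong L T v w \<Longrightarrow> word_cong L T u w"
| delete: "u \<in> lists L \<Longrightarrow> v \<in> lists L \<Longrightarrow> t \<in> T \<Longrightarrow> word_cong L T (u @ t @ v) (u @ v)"

lemma computable_lists:
  assumes "finite L" "computable f"
  shows "computable (\<lambda>x. f x \<in> lists L)"
  unfolding in_lists_conv_set
  by (intro computable_intros computable_finite_set assms)

text \<open>
  The rules of the inductive definition, read as a rule system on pairs of words. A premise only
  has to occur somewhere in the list of premises, so that the rules need not fix its order or length.
\<close>

lemma semidecidable_word_cong:
  fixes L :: "'l :: numbered set"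
  assumes L: "finite L" and T: "semidecidable (\<lambda>t. t \<in> T)"
  shows "semidecidable (\<lambda>p. word_cong L T (fst p) (snd p))"
proof -
  define R where "R ps c \<longleftrightarrow>
     (fst c = snd c \<and> fst c \<in> lists L) \<or> (snd c, fst c) \<in> set ps \<or>
     (\<exists>v. (fst c, v) \<in> set ps \<and> (v, snd c) \<in> set ps) \<or>
     (\<exists>u t v. u \<in> lists L \<and> v \<in> lists L \<and> t \<in> T \<and> c = (u @ t @ v, u @ v))"
    for ps and c :: "'l list \<times> 'l list"
  have "semidecidable (\<lambda>q. R (fst q) (snd q))"
    unfolding R_def
    by (intro semidecidable_disj semidecidable_Ex semidecidable_conj semidecidable_comp[OF T]
        semidecidable_computable computable_lists L computable_intros)
  then have "semidecidable (derivable R)" by (rule semidecidable_derivable)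
  moreover have "derivable R p \<longleftrightarrow> word_cong L T (fst p) (snd p)" for p
  proof
    show "derivable R p \<Longrightarrow> word_cong L T (fst p) (snd p)"
    proof (induction rule: derivable.induct)
      case (derive_step ps c)
      have IH: "word_cong L T u v" if "(u, v) \<in> set ps" for u v
        using derive_step.IH that by fastforce
      from derive_step.hyps show ?case
        unfolding R_def
      proof (elim disjE exE conjE)
        assume "fst c = snd c" "fst c \<in> lists L"
        then show ?thesis by (metis word_cong.refl)
      next
        assume "(snd c, fst c) \<in> set ps"
        then show ?thesis using IH word_cong.sym by blast
      next
        fix v assume "(fst c, v) \<in> set ps" "(v, snd c) \<in> set ps"
        then show ?thesis using IH word_cong.trans by blast
      next
        fix u t v assume "u \<in> lists L" "v \<in> lists L" "t \<in> T" "c = (u @ t @ v, u @ v)"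
        then show ?thesis using word_cong.delete[of u L v t T] by simp
      qed
    qed
  next
    have "word_cong L T u v \<Longrightarrow> derivable R (u, v)" for u v
    proof (induction rule: word_cong.induct)
      case (refl w)
      then have "R [] (w, w)" by (simp add: R_def)
      then show ?case by (rule derive_step) simp
    next
      case (sym u v)
      have "R [(u, v)] (v, u)" by (simp add: R_def)
      then show ?case by (rule derive_step) (simp add: sym.IH)
    next
      case (trans u v w)
      have "R [(u, v), (v, w)] (u, w)" unfolding R_def by auto
      then show ?case by (rule derive_step) (simp add: trans.IH)
    next
      case (delete u v t)
      then have "R [] (u @ t @ v, u @ v)" unfolding R_def by blast
      then show ?case by (rule derive_step) simp
    qed
    then show "word_cong L T (fst p) (snd p) \<Longrightarrow> derivable R p" by (metis prod.collapse)
  qed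
  ultimately show ?thesis by (simp add: semidecidable_def)
qed

lemma word_cong_map:
  "word_cong L T u v \<Longrightarrow> word_cong (f ` L) (map f ` T) (map f u) (map f v)"
proof (induction rule: word_cong.induct)
  case (delete u v t)
  then have "word_cong (f ` L) (map f ` T) (map f u @ map f t @ map f v) (map f u @ map f v)"
    by (intro word_cong.delete) auto
  then show ?case by simp
next
  case (refl w)
  then show ?case by (intro word_cong.refl) auto
next
  case (sym u v)
  then show ?case by (blast intro: word_cong.sym)
next
  case (trans u v w)
  then show ?case by (blast intro: word_cong.trans)
qed

lemma map_inv_into_map:
  "inj_on e S \<Longrightarrow> w \<in> lists S \<Longrightarrow> map (inv_into S e) (map e w) = w"
  by (induction w) auto

text \<open>Renaming preserves derivations; for an injective renaming the inverse renaming gives the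
  converse.\<close>

lemma word_cong_map_iff:
  assumes e: "inj_on e S" and T: "T \<subseteq> lists S" and "u \<in> lists S" "v \<in> lists S"
  shows "word_cong (e ` S) (map e ` T) (map e u) (map e v) \<longleftrightarrow> word_cong S T u v"
proof
  assume "word_cong (e ` S) (map e ` T) (map e u) (map e v)"
  from word_cong_map[OF this, of "inv_into S e"]
  have "word_cong (inv_into S e ` e ` S) (map (inv_into S e) ` map e ` T) u v"
    using assms by (simp add: map_inv_into_map del: map_map)
  moreover have "map (inv_into S e) ` map e ` T = T"
    using map_inv_into_map[OF e] T by (force simp: image_image simp del: map_map)
  moreover have "inv_into S e ` e ` S = S" using e by (simp add: inv_into_image_cancel)
  ultimately show "word_cong S T u v" by simp
qed (rule word_cong_map)

context group
begin

lemma word_value_Nil [simp]: "word_value G [] = \<one>"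
  and word_value_Cons [simp]: "word_value G (s # w) = s \<otimes> word_value G w"
  by (simp_all add: word_value_def)

lemma word_value_closed [simp]: "w \<in> lists (carrier G) \<Longrightarrow> word_value G w \<in> carrier G"
  by (induction w) auto

lemma word_value_append:
  "u \<in> lists (carrier G) \<Longrightarrow> v \<in> lists (carrier G) \<Longrightarrow>
     word_value G (u @ v) = word_value G u \<otimes> word_value G v"
  by (induction u) (auto simp: m_assoc)

lemma word_value_surj:
  assumes S: "symmetric_generating_set G S" and g: "g \<in> carrier G"
  shows "\<exists>w\<in>lists S. word_value G w = g"
proof -
  have sub: "S \<subseteq> carrier G" and inv: "\<And>s. s \<in> S \<Longrightarrow> inv s \<in> S"
    using S unfolding symmetric_generating_set_def by auto
  have "g \<in> generate G S" using S g unfolding symmetric_generating_set_def by simp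
  then show ?thesis
  proof induction
    case one
    show ?case by (intro bexI[of _ "[]"]) auto
  next
    case (incl h)
    then show ?case using sub by (intro bexI[of _ "[h]"]) auto
  next
    case (inv h)
    then show ?case using sub assms(1) unfolding symmetric_generating_set_def
      by (intro bexI[of _ "[inv h]"]) auto
  next
    case (eng h1 h2)
    then obtain u v where "u \<in> lists S" "v \<in> lists S" "word_value G u = h1" "word_value G v = h2"
      by blast
    moreover from this have "u \<in> lists (carrier G)" "v \<in> lists (carrier G)"
      using lists_mono[OF sub] by blast+
    ultimately have "u @ v \<in> lists S" "word_value G (u @ v) = h1 \<otimes> h2"
      using word_value_append[of u v] by auto
    then show ?case by blast
  qed
qed

end

lemma presentation_eq_lists:
  assumes "presentation_eq S R u v" "R \<subseteq> lists S"
  shows "u \<in> lists (S \<times> UNIV) \<and> v \<in> lists (S \<times> UNIV)"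
  using assms(1)
proof induction
  case (relator u v r)
  then have "r \<in> lists S" using assms(2) by blast
  then show ?case using relator by auto
qed auto

lemma presentation_eq_context:
  assumes "presentation_eq S R u v" "R \<subseteq> lists S"
    and xy: "x \<in> lists (S \<times> UNIV)" "y \<in> lists (S \<times> UNIV)"
  shows "presentation_eq S R (x @ u @ y) (x @ v @ y)"
  using assms(1)
proof induction
  case (refl w)
  then show ?case using xy by (intro presentation_eq.refl) auto
next
  case (sym u v)
  show ?case by (rule presentation_eq.sym) (fact sym.IH)
next
  case (trans u v w)
  then show ?case by (blast intro: presentation_eq.trans)
next
  case (cancel u v s b)
  then show ?case using presentation_eq.cancel[of "x @ u" S "v @ y" s R b] xy by simp
next
  case (relator u v r)
  then show ?case using presentation_eq.relator[of "x @ u" S "v @ y" r R] xy by simp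
qed

lemma presentation_rel_class_eq:
  assumes "presentation_eq S R u v"
  shows "presentation_rel S R `` {u} = presentation_rel S R `` {v}"
  using assms unfolding presentation_rel_def
  by (auto intro: presentation_eq.trans presentation_eq.sym)

text \<open>The product in the presented group is a union over all representatives; it is a single class
  because equality modulo relators is compatible with concatenation.\<close>

lemma presented_group_mult:
  assumes R: "R \<subseteq> lists S" and uv: "u \<in> lists (S \<times> UNIV)" "v \<in> lists (S \<times> UNIV)"
  shows "presentation_rel S R `` {u} \<otimes>\<^bsub>presented_group S R\<^esub> presentation_rel S R `` {v} =
    presentation_rel S R `` {u @ v}"
proof -
  have eq: "presentation_rel S R `` {u' @ v'} = presentation_rel S R `` {u @ v}"
    if "presentation_eq S R u u'" "presentation_eq S R v v'" for u' v'
  proof (rule presentation_rel_class_eq)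
    have "presentation_eq S R (u' @ v') (u' @ v)"
      using presentation_eq_context[OF presentation_eq.sym[OF that(2)] R, of u' "[]"]
        presentation_eq_lists[OF that(1) R] by simp
    moreover have "presentation_eq S R (u' @ v) (u @ v)"
      using presentation_eq_context[OF presentation_eq.sym[OF that(1)] R, of "[]" v] uv by simp
    ultimately show "presentation_eq S R (u' @ v') (u @ v)" by (rule presentation_eq.trans)
  qed
  have "presentation_rel S R `` {u} \<otimes>\<^bsub>presented_group S R\<^esub> presentation_rel S R `` {v} =
      (\<Union>u'\<in>presentation_rel S R `` {u}. \<Union>v'\<in>presentation_rel S R `` {v}.
        presentation_rel S R `` {u' @ v'})"
    by (simp add: presented_group_def)
  also have "\<dots> = (\<Union>u'\<in>presentation_rel S R `` {u}. \<Union>v'\<in>presentation_rel S R `` {v}.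
        presentation_rel S R `` {u @ v})"
    by (intro SUP_cong HOL.refl eq) (simp_all add: presentation_rel_def)
  also have "\<dots> = presentation_rel S R `` {u @ v}"
    using presentation_eq.refl[OF uv(1), of R] presentation_eq.refl[OF uv(2), of R]
    by (auto simp: presentation_rel_def)
  finally show ?thesis .
qed

text \<open>
  Every relator has value \<open>\<one>\<close>, because the isomorphism sends the class of a word to its value; so
  congruent words have equal values. Conversely, words of equal value are equal in the presented
  group by injectivity of the isomorphism, and a derivation there becomes a derivation of
  congruence when the formal inverse of \<open>s\<close> is replaced by the letter \<open>s\<^sup>-\<^sup>1\<close>.
\<close>

lemma (in group) word_cong_iff_word_value_eq:
  assumes S: "symmetric_generating_set G S" and R: "R \<subseteq> lists S"
    and pres: "has_presentation G S R"
    and uv: "u \<in> lists S" "v \<in> lists S"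
  shows "word_cong S (R \<union> (\<lambda>s. [s, inv s]) ` S) u v \<longleftrightarrow> word_value G u = word_value G v"
proof -
  let ?T = "R \<union> (\<lambda>s. [s, inv s]) ` S"
  let ?c = "\<lambda>w. presentation_rel S R `` {w}"
  let ?pos = "map (\<lambda>s. (s, True))"
  have sub: "S \<subseteq> carrier G" and inv_S: "\<And>s. s \<in> S \<Longrightarrow> inv s \<in> S"
    using S unfolding symmetric_generating_set_def by auto
  have lists_sub: "lists S \<subseteq> lists (carrier G)" using sub by (rule lists_mono)
  obtain \<phi> where \<phi>: "\<phi> \<in> iso (presented_group S R) G" "\<And>s. s \<in> S \<Longrightarrow> \<phi> (?c [(s, True)]) = s"
    using pres unfolding has_presentation_def by blast
  have class_carrier: "?c w \<in> carrier (presented_group S R)" if "w \<in> lists (S \<times> UNIV)" for w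
    using that by (auto simp: presented_group_def quotient_def)
  have pos: "?pos w \<in> lists (S \<times> UNIV)" if "w \<in> lists S" for w
    using that by auto
  have hom: "\<phi> (?c (x @ y)) = \<phi> (?c x) \<otimes> \<phi> (?c y)"
    if "x \<in> lists (S \<times> UNIV)" "y \<in> lists (S \<times> UNIV)" for x y
  proof -
    have "\<phi> \<in> hom (presented_group S R) G" using \<phi>(1) by (simp add: iso_def)
    from hom_mult[OF this class_carrier[OF that(1)] class_carrier[OF that(2)]] show ?thesis
      by (simp only: presented_group_mult[OF R that])
  qed
  have \<phi>_closed: "\<phi> (?c w) \<in> carrier G" if "w \<in> lists (S \<times> UNIV)" for w
    using \<phi>(1) hom_in_carrier[OF _ class_carrier[OF that]] unfolding iso_def by blast
  have \<phi>_value: "\<phi> (?c (?pos w)) = word_value G w" if "w \<in> lists S" for w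
    using that
  proof (induction w)
    case Nil
    \<comment> \<open>An idempotent of a group is the identity.\<close>
    have "\<phi> (?c []) = \<phi> (?c []) \<otimes> \<phi> (?c [])" using hom[of "[]" "[]"] by simp
    then show ?case using \<phi>_closed[of "[]"] by (simp add: l_cancel_one')
  next
    case (Cons s w)
    then show ?case using hom[of "[(s, True)]" "?pos w"] \<phi>(2) pos[of w] by auto
  qed
  have relator_value: "word_value G r = \<one>" if "r \<in> R" for r
  proof -
    have "presentation_eq S R (?pos r) []"
      using presentation_eq.relator[of "[]" S "[]" r R] that by simp
    then have "?c (?pos r) = ?c (?pos [])" by (simp add: presentation_rel_class_eq)
    then have "word_value G r = word_value G []" using \<phi>_value[of r] \<phi>_value[of "[]"] R that by force
    then show ?thesis by simp
  qed
  have T_value: "word_value G t = \<one> \<and> t \<in> lists S" if "t \<in> ?T" for t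
    using that relator_value R sub inv_S by auto
  have sound: "word_value G u = word_value G v" if "word_cong S ?T u v" for u v
    using that
  proof induction
    case (delete u v t)
    then have "u \<in> lists (carrier G)" "v \<in> lists (carrier G)" "t \<in> lists (carrier G)"
      "word_value G t = \<one>"
      using lists_sub T_value by blast+
    then show ?case by (simp add: word_value_append)
  qed auto
  define flat where "flat = map (\<lambda>(s, b). if b then s else inv s)"
  have flat_lists: "flat w \<in> lists S" if "w \<in> lists (S \<times> UNIV)" for w
    using that inv_S by (auto simp: flat_def in_lists_conv_set split: prod.splits)
  have flat_append: "flat (x @ y) = flat x @ flat y" for x y by (simp add: flat_def)
  have flat_pos: "flat (?pos w) = w" for w by (simp add: flat_def comp_def)
  have complete: "word_cong S ?T (flat x) (flat y)" if "presentation_eq S R x y" for x y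
    using that
  proof induction
    case (refl w)
    then show ?case by (intro word_cong.refl flat_lists)
  next
    case (sym u v)
    show ?case by (rule word_cong.sym) (fact sym.IH)
  next
    case (trans u v w)
    then show ?case by (blast intro: word_cong.trans)
  next
    case (cancel u v s b)
    have "flat [(s, b), (s, \<not> b)] \<in> ?T"
    proof (cases b)
      case False
      have "inv (inv s) = s" using sub cancel by (intro inv_inv) auto
      then have "[inv s, s] = (\<lambda>s. [s, inv s]) (inv s)" by simp
      then show ?thesis using False inv_S[OF cancel(3)] by (auto simp: flat_def)
    qed (use cancel in \<open>auto simp: flat_def\<close>)
    then show ?case
      using word_cong.delete[of "flat u" S "flat v" "flat [(s, b), (s, \<not> b)]" ?T] cancel flat_lists
      by (simp only: flat_append)
  next
    case (relator u v r)
    then show ?case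
      using word_cong.delete[of "flat u" S "flat v" r ?T] flat_lists
      by (simp add: flat_append flat_pos)
  qed
  show ?thesis
  proof
    assume "word_value G u = word_value G v"
    then have "\<phi> (?c (?pos u)) = \<phi> (?c (?pos v))" using \<phi>_value uv by simp
    moreover have "inj_on \<phi> (carrier (presented_group S R))"
      using \<phi>(1) unfolding iso_def bij_betw_def by auto
    ultimately have "?c (?pos u) = ?c (?pos v)"
      using class_carrier pos uv by (meson inj_onD)
    moreover have "presentation_eq S R (?pos v) (?pos v)"
      using pos uv by (intro presentation_eq.refl)
    ultimately have "presentation_eq S R (?pos u) (?pos v)"
      unfolding presentation_rel_def by blast
    from complete[OF this] show "word_cong S ?T u v" by (simp only: flat_pos)
  qed (rule sound)
qed

definition decoded_value :: "('g, 'm) monoid_scheme \<Rightarrow> 'g set \<Rightarrow> ('g \<Rightarrow> nat) \<Rightarrow> nat list \<Rightarrow> 'g" where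
  "decoded_value G S e w = word_value G (map (inv_into S e) w)"

text \<open>
  The generators \<^term>\<open>S\<close> and their numbering \<^term>\<open>e\<close> are arbitrary, whereas the presentation comes
  with generators and a numbering of its own. A computable translation, given by a table on letters,
  reduces equality of words over \<^term>\<open>S\<close> to congruence of words over the generators of the
  presentation.
\<close>

lemma (in group) semidecidable_word_problem:
  assumes S: "symmetric_generating_set G S" and e: "inj_on e S"
    and G: "recursively_presented G"
  shows "semidecidable (\<lambda>p. fst p \<in> lists (e ` S) \<and> snd p \<in> lists (e ` S) \<and>
    decoded_value G S e (fst p) = decoded_value G S e (snd p))"
proof -
  obtain S' R e' where S': "symmetric_generating_set G S'" and R: "R \<subseteq> lists S'"
    and e': "inj_on e' S'" and re: "recursively_enumerable (word_code e' ` R)"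
    and pres: "has_presentation G S' R"
    using G unfolding recursively_presented_def re_words_def by blast
  have fin: "finite S" "finite S'" and sub: "S \<subseteq> carrier G" "S' \<subseteq> carrier G"
    and inv_S': "\<And>s. s \<in> S' \<Longrightarrow> inv s \<in> S'"
    using S S' unfolding symmetric_generating_set_def by auto
  let ?T = "R \<union> (\<lambda>s. [s, inv s]) ` S'"
  have "word_code e' ` R = code ` map e' ` R"
    by (simp add: word_code_def code_list_def image_image code_nat_def[abs_def])
  then have "semidecidable (\<lambda>n. n \<in> (code ` map e' ` R :: nat set))"
    using re recursively_enumerable_iff_semidecidable by metis
  then have "semidecidable (\<lambda>w :: nat list. code w \<in> (code ` map e' ` R :: nat set))"
    by (rule semidecidable_comp) (intro computable_intros)
  then have "semidecidable (\<lambda>w. w \<in> map e' ` R)"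
    by (simp add: inj_image_mem_iff[OF inj_code])
  moreover have "semidecidable (\<lambda>w. w \<in> map e' ` (\<lambda>s. [s, inv s]) ` S')"
    using fin by (intro semidecidable_computable computable_finite_set computable_intros) auto
  ultimately have "semidecidable (\<lambda>w. w \<in> map e' ` R \<or> w \<in> map e' ` (\<lambda>s. [s, inv s]) ` S')"
    by (rule semidecidable_disj)
  then have T: "semidecidable (\<lambda>w. w \<in> map e' ` ?T)"
    by (simp add: image_Un)
  have T_lists: "?T \<subseteq> lists S'" using R inv_S' by auto
  obtain \<tau> where \<tau>: "\<And>s. s \<in> S \<Longrightarrow> \<tau> s \<in> lists S'" "\<And>s. s \<in> S \<Longrightarrow> word_value G (\<tau> s) = s"
    using word_value_surj[OF S'] sub by (metis subsetD)
  obtain h where h: "computable h" "\<And>n. n \<in> e ` S \<Longrightarrow> h n = map e' (\<tau> (inv_into S e n))"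
    using computable_extension_of_finite[of "e ` S" "\<lambda>n. map e' (\<tau> (inv_into S e n))"] fin by auto
  define tr where "tr w = concat (map h w)" for w
  have tr: "computable tr"
    unfolding tr_def by (intro computable_intros computable_comp[OF h(1)])
  have tr_eq: "\<exists>w'\<in>lists S'. tr w = map e' w' \<and> word_value G w' = decoded_value G S e w"
    if "w \<in> lists (e ` S)" for w
    using that
  proof (induction w)
    case Nil
    show ?case by (intro bexI[of _ "[]"]) (simp_all add: tr_def decoded_value_def)
  next
    case (Cons n w)
    then obtain w' where w': "w' \<in> lists S'" "tr w = map e' w'"
      "word_value G w' = decoded_value G S e w" by auto
    define s where "s = inv_into S e n"
    have s: "s \<in> S" "h n = map e' (\<tau> s)"
      using Cons h(2) by (auto simp: s_def inv_into_into)
    have "lists S' \<subseteq> lists (carrier G)" using sub(2) by (rule lists_mono)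
    then have "word_value G (\<tau> s @ w') = decoded_value G S e (n # w)"
      using word_value_append[of "\<tau> s" w'] w' \<tau>[OF s(1)] s
      by (auto simp: decoded_value_def s_def)
    then show ?case using w' s \<tau>(1)[OF s(1)]
      by (intro bexI[of _ "\<tau> s @ w'"]) (auto simp: tr_def)
  qed
  have iff: "word_cong (e' ` S') (map e' ` ?T) (tr u) (tr v) \<longleftrightarrow>
      decoded_value G S e u = decoded_value G S e v"
    if uv: "u \<in> lists (e ` S)" "v \<in> lists (e ` S)" for u v
  proof -
    obtain u' where u': "u' \<in> lists S'" "tr u = map e' u'" "word_value G u' = decoded_value G S e u"
      using tr_eq[OF uv(1)] by blast
    obtain v' where v': "v' \<in> lists S'" "tr v = map e' v'" "word_value G v' = decoded_value G S e v"
      using tr_eq[OF uv(2)] by blast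
    show ?thesis
      unfolding u'(2) v'(2) word_cong_map_iff[OF e' T_lists u'(1) v'(1)]
        word_cong_iff_word_value_eq[OF S' R pres u'(1) v'(1)] u'(3) v'(3) ..
  qed
  have cong: "semidecidable (\<lambda>p. word_cong (e' ` S') (map e' ` ?T) (fst p) (snd p))"
    using fin T by (intro semidecidable_word_cong) auto
  have tr_cong: "semidecidable (\<lambda>p. word_cong (e' ` S') (map e' ` ?T) (tr (fst p)) (tr (snd p)))"
    using semidecidable_comp[OF cong, of "\<lambda>p. (tr (fst p), tr (snd p))"]
    by (simp add: computable_intros computable_comp[OF tr])
  have "semidecidable (\<lambda>p. fst p \<in> lists (e ` S) \<and> snd p \<in> lists (e ` S) \<and>
      word_cong (e' ` S') (map e' ` ?T) (tr (fst p)) (tr (snd p)))"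
    by (intro semidecidable_conj tr_cong semidecidable_computable computable_lists
        computable_intros finite_imageI fin)
  then show ?thesis by (simp only: iff cong: conj_cong)
qed

section \<open>Refuting patterns\<close>

text \<open>
  The list \<open>p\<close> is a partial labeling of the words over \<open>L\<close> by letters of \<open>B\<close>. A refutation shows
  that it has no total extension that respects \<open>E\<close> and shows no translate of a member of \<open>F\<close>. The
  intended \<open>E\<close> is equality in the group, and \<open>F\<close> consists of the forbidden patterns.
\<close>

inductive refutable ::
  "'l set \<Rightarrow> 'b set \<Rightarrow> ('l list \<times> 'l list) set \<Rightarrow> ('l list \<times> 'b) list set \<Rightarrow> ('l list \<times> 'b) list \<Rightarrow> bool"
  for L B E F where
  clash: "(w, a) \<in> set p \<Longrightarrow> (w', b) \<in> set p \<Longrightarrow> (w, w') \<in> E \<Longrightarrow> a \<noteq> b \<Longrightarrow> refutable L B E F p"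
| occurrence: "q \<in> F \<Longrightarrow> u \<in> lists L \<Longrightarrow> \<forall>(w, a)\<in>set q. (u @ w, a) \<in> set p \<Longrightarrow> refutable L B E F p"
| branch: "w \<in> lists L \<Longrightarrow> \<forall>b\<in>B. refutable L B E F ((w, b) # p) \<Longrightarrow> refutable L B E F p"

text \<open>Branching has finitely many premises because \<open>B\<close> is finite.\<close>

lemma semidecidable_refutable:
  fixes L :: "'l :: numbered set" and B :: "'b :: numbered set"
  assumes L: "finite L" and B: "finite B"
    and E: "semidecidable (\<lambda>p. p \<in> E)" and F: "semidecidable (\<lambda>q. q \<in> F)"
  shows "semidecidable (refutable L B E F)"
proof -
  obtain bs where bs: "B = set bs" using B finite_list by auto
  define R where "R ps p \<longleftrightarrow>
     (\<exists>w a w' b. (w, a) \<in> set p \<and> (w', b) \<in> set p \<and> (w, w') \<in> E \<and> a \<noteq> b) \<or>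
     (\<exists>q u. q \<in> F \<and> u \<in> lists L \<and> (\<forall>e\<in>set q. (u @ fst e, snd e) \<in> set p)) \<or>
     (\<exists>w. w \<in> lists L \<and> (\<forall>b\<in>set bs. (w, b) # p \<in> set ps))"
    for ps and p :: "('l list \<times> 'b) list"
  have "semidecidable (\<lambda>q. R (fst q) (snd q))"
    unfolding R_def
    by (intro semidecidable_disj semidecidable_Ex semidecidable_conj semidecidable_comp[OF E]
        semidecidable_comp[OF F] semidecidable_computable computable_lists L computable_intros)
  then have "semidecidable (derivable R)" by (rule semidecidable_derivable)
  moreover have "derivable R = refutable L B E F"
  proof (intro ext iffI)
    fix p assume "derivable R p"
    then show "refutable L B E F p"
    proof induction
      case (derive_step ps p)
      from derive_step.hyps show ?case
        unfolding R_def
      proof (elim disjE exE conjE)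
        fix w a w' b assume "(w, a) \<in> set p" "(w', b) \<in> set p" "(w, w') \<in> E" "a \<noteq> b"
        then show ?thesis by (rule refutable.clash)
      next
        fix q u assume "q \<in> F" "u \<in> lists L" "\<forall>e\<in>set q. (u @ fst e, snd e) \<in> set p"
        then show ?thesis by (intro refutable.occurrence[of q]) auto
      next
        fix w assume "w \<in> lists L" "\<forall>b\<in>set bs. (w, b) # p \<in> set ps"
        then show ?thesis using derive_step.IH bs by (intro refutable.branch[of w]) auto
      qed
    qed
  next
    fix p assume "refutable L B E F p"
    then show "derivable R p"
    proof induction
      case (clash w a p w' b)
      then have "R [] p" unfolding R_def by blast
      then show ?case by (rule derive_step) simp
    next
      case (occurrence q u p)
      then have "R [] p" unfolding R_def by fastforce
      then show ?case by (rule derive_step) simp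
    next
      case (branch w p)
      then have "R (map (\<lambda>b. (w, b) # p) bs) p" unfolding R_def by auto
      then show ?case by (rule derive_step) (use branch bs in auto)
    qed
  qed
  ultimately show ?thesis by simp
qed

definition admissible ::
  "'l set \<Rightarrow> 'b set \<Rightarrow> ('l list \<times> 'l list) set \<Rightarrow> ('l list \<times> 'b) list set \<Rightarrow> ('l list \<Rightarrow> 'b) \<Rightarrow> bool" where
  "admissible L B E F y \<longleftrightarrow> (\<forall>w\<in>lists L. y w \<in> B) \<and> (\<forall>(w, w')\<in>E. y w = y w') \<and>
     (\<forall>q\<in>F. \<forall>u\<in>lists L. \<exists>(w, a)\<in>set q. y (u @ w) \<noteq> a)"

lemma refutable_sound:
  assumes "refutable L B E F p" "admissible L B E F y" "\<forall>(w, a)\<in>set p. y w = a"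
  shows False
  using assms
proof induction
  case (clash w a p w' b)
  then have "y w = a" "y w' = b" by auto
  moreover have "y w = y w'" using clash unfolding admissible_def by fast
  ultimately show ?case using clash by simp
next
  case (occurrence q u p)
  then have "\<exists>(w, a)\<in>set q. y (u @ w) \<noteq> a" unfolding admissible_def by blast
  then obtain w a where wa: "(w, a) \<in> set q" "y (u @ w) \<noteq> a" by blast
  then have "(u @ w, a) \<in> set p" using occurrence.hyps by auto
  then show ?case using wa occurrence.prems by auto
next
  case (branch w p)
  then have "y w \<in> B" unfolding admissible_def by blast
  then show ?case using branch by auto
qed

text \<open>
  By the branching rule, a labeling that is not refutable stays so for some choice of a letter at
  any further word. The words are treated in the order of an enumeration, and the labelings
  \<open>P n\<close> obtained grow to a relation \<open>U\<close> on words and letters that is total. A clash in \<open>U\<close>, or an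
  occurrence of a forbidden pattern, involves finitely many pairs only, so it would be present in
  some \<open>P n\<close> and refute it.
\<close>

lemma refutable_complete:
  fixes L :: "'l :: countable set" and B :: "'b set"
  assumes E: "E \<subseteq> lists L \<times> lists L" and E_refl: "\<And>w. w \<in> lists L \<Longrightarrow> (w, w) \<in> E"
    and F: "\<And>q. q \<in> F \<Longrightarrow> set q \<subseteq> lists L \<times> B"
    and p: "set p \<subseteq> lists L \<times> B" and not_ref: "\<not> refutable L B E F p"
  obtains y where "admissible L B E F y" "\<forall>(w, a)\<in>set p. y w = a"
proof -
  define next_ok where "next_ok n r r' \<longleftrightarrow> set r \<subseteq> set r' \<and>
    (from_nat n \<in> lists L \<longrightarrow> (\<exists>b. (from_nat n, b) \<in> set r'))"
    for n and r r' :: "('l list \<times> 'b) list"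
  have "\<exists>P. \<forall>n. (set (P n) \<subseteq> lists L \<times> B \<and> \<not> refutable L B E F (P n) \<and> (n = 0 \<longrightarrow> P n = p)) \<and>
      next_ok n (P n) (P (Suc n))"
  proof (rule dependent_nat_choice)
    show "\<exists>r. set r \<subseteq> lists L \<times> B \<and> \<not> refutable L B E F r \<and> (0 = (0 :: nat) \<longrightarrow> r = p)"
      using p not_ref by blast
  next
    fix r and n :: nat
    assume r: "set r \<subseteq> lists L \<times> B \<and> \<not> refutable L B E F r \<and> (n = 0 \<longrightarrow> r = p)"
    show "\<exists>r'. (set r' \<subseteq> lists L \<times> B \<and> \<not> refutable L B E F r' \<and> (Suc n = 0 \<longrightarrow> r' = p)) \<and>
      next_ok n r r'"
    proof (cases "from_nat n \<in> lists L")
      case True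
      then obtain b where "b \<in> B" "\<not> refutable L B E F ((from_nat n, b) # r)"
        using r refutable.branch[OF True, of B E F r] by blast
      then show ?thesis using r True
        by (intro exI[of _ "(from_nat n, b) # r"]) (auto simp: next_ok_def)
    next
      case False
      then show ?thesis using r by (intro exI[of _ r]) (auto simp: next_ok_def)
    qed
  qed
  then obtain P where P: "\<And>n. set (P n) \<subseteq> lists L \<times> B" "\<And>n. \<not> refutable L B E F (P n)"
    "P 0 = p" "\<And>n. next_ok n (P n) (P (Suc n))"
    by blast
  have "set (P n) \<subseteq> set (P (Suc n))" for n using P(4) unfolding next_ok_def by blast
  then have mono: "set (P m) \<subseteq> set (P n)" if "m \<le> n" for m n
    using that lift_Suc_mono_le[of "\<lambda>n. set (P n)"] by blast
  define U where "U = (\<Union>n. set (P n))"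
  have finite_sub: "\<exists>n. D \<subseteq> set (P n)" if "finite D" "D \<subseteq> U" for D
    using that
  proof induction
    case (insert x D)
    then obtain m n where "D \<subseteq> set (P n)" "x \<in> set (P m)" unfolding U_def by blast
    then have "insert x D \<subseteq> set (P (max m n))"
      using mono[of m "max m n"] mono[of n "max m n"] by auto
    then show ?case by blast
  qed simp
  have total: "\<exists>b. (w, b) \<in> U" if "w \<in> lists L" for w
    using P(4)[of "to_nat w"] that unfolding next_ok_def U_def by auto
  have consistent: "a = b" if ab: "(w, a) \<in> U" "(w', b) \<in> U" "(w, w') \<in> E" for w w' a b
  proof (rule ccontr)
    assume "a \<noteq> b"
    obtain n where "(w, a) \<in> set (P n)" "(w', b) \<in> set (P n)"
      using finite_sub[of "{(w, a), (w', b)}"] ab by auto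
    then have "refutable L B E F (P n)" using ab(3) \<open>a \<noteq> b\<close> by (rule refutable.clash)
    then show False using P(2) by blast
  qed
  define y where "y w = (SOME b. (w, b) \<in> U)" for w
  have y_in: "(w, y w) \<in> U" if "w \<in> lists L" for w
    using total[OF that] unfolding y_def by (rule someI_ex)
  have U_sub: "U \<subseteq> lists L \<times> B" using P(1) unfolding U_def by blast
  have y_eq: "y w = a" if "(w, a) \<in> U" for w a
    using that y_in consistent[of w "y w" w a] E_refl U_sub by blast
  have "admissible L B E F y"
    unfolding admissible_def
  proof (intro conjI ballI)
    fix w assume "w \<in> lists L"
    then show "y w \<in> B" using y_in U_sub by blast
  next
    fix x assume "x \<in> E"
    moreover obtain w w' where x: "x = (w, w')" by (cases x)
    ultimately have "w \<in> lists L" "w' \<in> lists L" "(w, w') \<in> E" using E by auto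
    then have "y w = y w'" by (intro consistent[OF y_in y_in])
    then show "case x of (w, w') \<Rightarrow> y w = y w'" by (simp add: x)
  next
    fix q u assume q: "q \<in> F" and u: "u \<in> lists L"
    show "\<exists>(w, a)\<in>set q. y (u @ w) \<noteq> a"
    proof (rule ccontr)
      assume "\<not> (\<exists>(w, a)\<in>set q. y (u @ w) \<noteq> a)"
      then have "\<forall>(w, a)\<in>set q. y (u @ w) = a" by auto
      then have y_q: "y (u @ w) = a" if "(w, a) \<in> set q" for w a using that by auto
      have "(u @ w, a) \<in> U" if "(w, a) \<in> set q" for w a
      proof -
        have "u @ w \<in> lists L" using F[OF q] u that by auto
        then show ?thesis using y_in y_q[OF that] by blast
      qed
      then have "(\<lambda>(w, a). (u @ w, a)) ` set q \<subseteq> U" by auto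
      then obtain n where "(\<lambda>(w, a). (u @ w, a)) ` set q \<subseteq> set (P n)"
        using finite_sub[of "(\<lambda>(w, a). (u @ w, a)) ` set q"] by blast
      then have "refutable L B E F (P n)"
        using q u by (intro refutable.occurrence[of q]) auto
      then show False using P(2) by blast
    qed
  qed
  moreover have "\<forall>(w, a)\<in>set p. y w = a"
    using y_eq P(3) unfolding U_def by blast
  ultimately show ?thesis using that by blast
qed

section \<open>Pattern codings as lists of numbers\<close>

definition encode_coding ::
  "('g \<Rightarrow> nat) \<Rightarrow> ('a \<Rightarrow> nat) \<Rightarrow> ('g, 'a) pattern_coding \<Rightarrow> (nat list \<times> nat) set" where
  "encode_coding e d c = (\<lambda>(w, a). (map e w, d a)) ` c"

text \<open>
  Codings are finite sets, coded by sums of powers of 2, while the rule systems work on lists. On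
  lists without repetition the code of the underlying set is computed by a plain summation.
\<close>

definition list_code :: "(nat list \<times> nat) list \<Rightarrow> nat" where
  "list_code q = fold (\<lambda>x n. n + 2 ^ code x) q 0"

lemma computable_list_code: "computable list_code"
  unfolding list_code_def[abs_def] by (intro computable_intros)

lemma list_code_distinct:
  assumes "distinct q"
  shows "list_code q = set_encode (code ` set q)"
proof -
  have "fold (\<lambda>x n. n + 2 ^ code x) q m = m + (\<Sum>x\<in>set q. 2 ^ code x)" for m :: nat
    using assms by (induction q arbitrary: m) auto
  moreover have "set_encode (code ` set q) = (\<Sum>x\<in>set q. 2 ^ code x)"
    unfolding set_encode_def by (rule sum.reindex[unfolded comp_def]) (auto simp: inj_on_def)
  ultimately show ?thesis by (simp add: list_code_def)
qed

lemma pattern_coding_code_eq: "pattern_coding_code e d c = set_encode (code ` encode_coding e d c)"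
  unfolding pattern_coding_code_def encode_coding_def image_image
  by (intro arg_cong[where f = set_encode] image_cong HOL.refl)
    (auto simp: word_code_def code_prod_def code_list_def code_nat_def[abs_def])

lemma list_code_eq_pattern_coding_code_iff:
  assumes "distinct q" "finite c"
  shows "list_code q = pattern_coding_code e d c \<longleftrightarrow> set q = encode_coding e d c"
  using assms
  by (simp add: list_code_distinct pattern_coding_code_eq set_encode_eq encode_coding_def
      inj_image_eq_iff[OF inj_code])

definition coding_lists :: "('g \<Rightarrow> nat) \<Rightarrow> ('a \<Rightarrow> nat) \<Rightarrow> ('g, 'a) pattern_coding set \<Rightarrow>
    (nat list \<times> nat) list set" where
  "coding_lists e d C = {q. distinct q \<and> (\<exists>c\<in>C. set q = encode_coding e d c)}"

text \<open>The lists of a set of codings are a computable many-to-one presentation of it; thus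
  recursive enumerability can be tested on lists.\<close>

lemma pattern_coding_code_image:
  assumes "\<And>c. c \<in> C \<Longrightarrow> finite c"
  shows "pattern_coding_code e d ` C = list_code ` coding_lists e d C"
proof (intro subset_antisym subsetI)
  fix n assume "n \<in> pattern_coding_code e d ` C"
  then obtain c where c: "c \<in> C" "n = pattern_coding_code e d c" by blast
  have "finite (encode_coding e d c)" using assms[OF c(1)] by (simp add: encode_coding_def)
  then obtain q where q: "distinct q" "set q = encode_coding e d c"
    using finite_distinct_list by blast
  then have "list_code q = n"
    using c assms list_code_eq_pattern_coding_code_iff by blast
  then show "n \<in> list_code ` coding_lists e d C"
    using q c(1) unfolding coding_lists_def by blast
next
  fix n assume "n \<in> list_code ` coding_lists e d C"
  then obtain q c where "n = list_code q" "distinct q" "c \<in> C" "set q = encode_coding e d c"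
    unfolding coding_lists_def by blast
  moreover from this have "list_code q = pattern_coding_code e d c"
    using list_code_eq_pattern_coding_code_iff assms by blast
  ultimately show "n \<in> pattern_coding_code e d ` C" by blast
qed

lemma recursively_enumerable_codings_iff:
  assumes fin: "\<And>c. c \<in> C \<Longrightarrow> finite c"
  shows "recursively_enumerable (pattern_coding_code e d ` C) \<longleftrightarrow>
    semidecidable (\<lambda>q. q \<in> coding_lists e d C)"
proof
  assume "recursively_enumerable (pattern_coding_code e d ` C)"
  then have "semidecidable (\<lambda>n. n \<in> pattern_coding_code e d ` C)"
    by (simp only: recursively_enumerable_iff_semidecidable)
  from semidecidable_comp[OF this computable_list_code]
  have "semidecidable (\<lambda>q. distinct q \<and> list_code q \<in> pattern_coding_code e d ` C)"
    by (intro semidecidable_conj semidecidable_computable[OF computable_distinct] computable_id)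
  moreover have "distinct q \<and> list_code q \<in> pattern_coding_code e d ` C \<longleftrightarrow> q \<in> coding_lists e d C" for q
    using list_code_eq_pattern_coding_code_iff[of q] fin unfolding coding_lists_def by blast
  ultimately show "semidecidable (\<lambda>q. q \<in> coding_lists e d C)" by simp
next
  assume "semidecidable (\<lambda>q. q \<in> coding_lists e d C)"
  then show "recursively_enumerable (pattern_coding_code e d ` C)"
    by (simp only: recursively_enumerable_iff_semidecidable pattern_coding_code_image[OF fin]
        semidecidable_image computable_list_code)
qed

section \<open>The maximal set of pattern codings\<close>

definition avoided_codings :: "('g, 'm) monoid_scheme \<Rightarrow> 'g set \<Rightarrow> 'a set \<Rightarrow> ('g \<Rightarrow> 'a) set \<Rightarrow>
    ('g, 'a) pattern_coding set" where
  "avoided_codings G S A X =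
     {c \<in> pattern_codings S A. \<not> (\<exists>x\<in>X. \<forall>(w, a)\<in>c. x (word_value G w) = a)}"

lemma configurations_eq: "configurations G A = carrier G \<rightarrow>\<^sub>E A"
  by (simp add: full_shift_def)

lemma mem_defined_set_iff:
  "x \<in> defined_set G A C \<longleftrightarrow> x \<in> configurations G A \<and>
     (\<forall>g\<in>carrier G. \<forall>c\<in>C. \<exists>(w, a)\<in>c. x (g \<otimes>\<^bsub>G\<^esub> word_value G w) \<noteq> a)"
proof (cases "x \<in> configurations G A")
  case True
  then have "x \<in> cylinder G A h a \<longleftrightarrow> x h = a" for h a
    by (simp add: cylinder_def)
  then show ?thesis
    unfolding defined_set_def by (simp add: True case_prod_beta)
qed (simp add: defined_set_def)

context group
begin

text \<open>Look at the identity of the group: there, no configuration of \<open>X\<close> shows a coding of \<open>C\<close>.\<close>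

lemma codings_define_imp_subset_avoided:
  assumes S: "S \<subseteq> carrier G" and C: "codings_define G S A C X"
  shows "C \<subseteq> avoided_codings G S A X"
proof
  fix c assume c: "c \<in> C"
  then have c': "c \<in> pattern_codings S A" using C unfolding codings_define_def by blast
  have "\<exists>(w, a)\<in>c. x (word_value G w) \<noteq> a" if "x \<in> X" for x
  proof -
    have "x \<in> defined_set G A C" using that C unfolding codings_define_def by simp
    then have "\<exists>(w, a)\<in>c. x (\<one> \<otimes> word_value G w) \<noteq> a"
      using c unfolding mem_defined_set_iff by blast
    then obtain w a where wa: "(w, a) \<in> c" "x (\<one> \<otimes> word_value G w) \<noteq> a" by blast
    then have "w \<in> lists S" using c' unfolding pattern_codings_def by blast
    then have "w \<in> lists (carrier G)" using lists_mono[OF S] by blast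
    then have "x (word_value G w) \<noteq> a" using wa(2) by simp
    then show ?thesis using wa(1) by blast
  qed
  then show "c \<in> avoided_codings G S A X"
    using c' unfolding avoided_codings_def by (auto simp: case_prod_beta)
qed

text \<open>
  If a configuration of \<open>X\<close> showed an avoided coding at \<open>g\<close>, then its shift by \<open>g\<^sup>-\<^sup>1\<close>, which is
  in \<open>X\<close>, would show it at the identity. Conversely, a larger set of codings defines a smaller
  set of configurations.
\<close>

lemma avoided_codings_define:
  assumes S: "S \<subseteq> carrier G" and C: "codings_define G S A C X" and X: "subshift G A X"
  shows "codings_define G S A (avoided_codings G S A X) X"
proof -
  have "X = defined_set G A (avoided_codings G S A X)"
  proof (intro subset_antisym subsetI)
    fix x assume x: "x \<in> X"
    show "x \<in> defined_set G A (avoided_codings G S A X)"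
      unfolding mem_defined_set_iff
    proof (intro conjI ballI)
      show "x \<in> configurations G A"
        using x X closedin_subset unfolding subshift_def by blast
    next
      fix g c assume g: "g \<in> carrier G" and c: "c \<in> avoided_codings G S A X"
      have "shift G (inv g) x \<in> X" using X x g unfolding subshift_def by blast
      then have "\<not> (\<forall>(w, a)\<in>c. shift G (inv g) x (word_value G w) = a)"
        using c unfolding avoided_codings_def by blast
      then obtain w a where wa: "(w, a) \<in> c" "shift G (inv g) x (word_value G w) \<noteq> a" by blast
      have "w \<in> lists S" using wa(1) c unfolding avoided_codings_def pattern_codings_def by blast
      then have "w \<in> lists (carrier G)" using lists_mono[OF S] by blast
      then have "x (g \<otimes> word_value G w) \<noteq> a" using wa(2) g by (simp add: shift_def)
      then show "\<exists>(w, a)\<in>c. x (g \<otimes> word_value G w) \<noteq> a" using wa(1) by blast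
    qed
  next
    fix x assume "x \<in> defined_set G A (avoided_codings G S A X)"
    then have "x \<in> defined_set G A C"
      using codings_define_imp_subset_avoided[OF S C] unfolding mem_defined_set_iff by blast
    then show "x \<in> X" using C unfolding codings_define_def by simp
  qed
  then show ?thesis unfolding codings_define_def avoided_codings_def by auto
qed

lemma decoded_value_map:
  "inj_on e S \<Longrightarrow> w \<in> lists S \<Longrightarrow> decoded_value G S e (map e w) = word_value G w"
  by (simp only: decoded_value_def map_inv_into_map)

lemma lists_image_obtain:
  assumes "u \<in> lists (e ` S)"
  obtains w where "w \<in> lists S" "u = map e w"
  using assms by (auto simp: lists_image)

text \<open>
  A configuration labels each word by the letter at the value of the word. Conversely, a labeling
  that respects equality in \<open>G\<close> comes from a configuration, because each element of \<open>G\<close> is the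
  value of a word over \<open>S\<close>. Translating a pattern by \<open>g\<close> means prefixing its words with a word of
  value \<open>g\<close>.
\<close>

lemma ex_config_iff_ex_labeling:
  assumes S: "symmetric_generating_set G S" and e: "inj_on e S" and d: "inj_on d A"
    and C: "codings_define G S A C X" and c: "c \<in> pattern_codings S A"
    and q: "set q = encode_coding e d c"
  defines "E \<equiv> {(u, v). u \<in> lists (e ` S) \<and> v \<in> lists (e ` S) \<and>
      decoded_value G S e u = decoded_value G S e v}"
  shows "(\<exists>x\<in>X. \<forall>(w, a)\<in>c. x (word_value G w) = a) \<longleftrightarrow>
    (\<exists>y. admissible (e ` S) (d ` A) E (coding_lists e d C) y \<and> (\<forall>(w, a)\<in>set q. y w = a))"
proof -
  have sub: "S \<subseteq> carrier G" using S unfolding symmetric_generating_set_def by blast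
  have lists_sub: "w \<in> lists (carrier G)" if "w \<in> lists S" for w
    using that lists_mono[OF sub] by blast
  have C_sub: "C \<subseteq> pattern_codings S A" and X: "X = defined_set G A C"
    using C unfolding codings_define_def by blast+
  have coding: "w \<in> lists S \<and> a \<in> A" if "c \<in> pattern_codings S A" "(w, a) \<in> c" for c w a
    using that unfolding pattern_codings_def by blast
  have value_map: "decoded_value G S e (map e w) = word_value G w" if "w \<in> lists S" for w
    using e that by (rule decoded_value_map)
  show ?thesis
  proof
    assume "\<exists>x\<in>X. \<forall>(w, a)\<in>c. x (word_value G w) = a"
    then obtain x where x: "x \<in> X" and xc: "\<forall>(w, a)\<in>c. x (word_value G w) = a" by blast
    define y where "y u = d (x (decoded_value G S e u))" for u
    have y_map: "y (map e w) = d (x (word_value G w))" if "w \<in> lists S" for w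
      using that by (simp only: y_def value_map)
    have x_A: "x g \<in> A" if "g \<in> carrier G" for g
      using x that unfolding X mem_defined_set_iff configurations_eq by blast
    have "admissible (e ` S) (d ` A) E (coding_lists e d C) y"
      unfolding admissible_def
    proof (intro conjI ballI)
      fix u assume "u \<in> lists (e ` S)"
      then obtain w where "w \<in> lists S" "u = map e w" by (rule lists_image_obtain)
      then show "y u \<in> d ` A" using x_A lists_sub y_map by simp
    next
      fix p assume "p \<in> E"
      then show "case p of (u, v) \<Rightarrow> y u = y v" by (auto simp: E_def y_def)
    next
      fix r u assume r: "r \<in> coding_lists e d C" and u: "u \<in> lists (e ` S)"
      obtain v where v: "v \<in> lists S" "u = map e v" using u by (rule lists_image_obtain)
      obtain c' where c': "c' \<in> C" "set r = encode_coding e d c'"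
        using r unfolding coding_lists_def by blast
      obtain w a where wa: "(w, a) \<in> c'" "x (word_value G v \<otimes> word_value G w) \<noteq> a"
        using x c'(1) word_value_closed[OF lists_sub[OF v(1)]]
        unfolding X mem_defined_set_iff by blast
      have wS: "w \<in> lists S" "a \<in> A" using coding[of c' w a] c'(1) C_sub wa(1) by auto
      have vw: "word_value G (v @ w) = word_value G v \<otimes> word_value G w"
        using lists_sub v(1) wS(1) by (intro word_value_append)
      have "y (u @ map e w) = d (x (word_value G v \<otimes> word_value G w))"
        using y_map[of "v @ w"] v wS(1) by (simp add: vw)
      moreover have "word_value G v \<otimes> word_value G w \<in> carrier G"
        using lists_sub v(1) wS(1) by simp
      ultimately have "y (u @ map e w) \<noteq> d a"
        using wa(2) x_A wS(2) d by (metis inj_onD)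
      moreover have "(map e w, d a) \<in> set r"
        using wa(1) unfolding c'(2) encode_coding_def by force
      ultimately show "\<exists>(w, a)\<in>set r. y (u @ w) \<noteq> a" by blast
    qed
    moreover have "\<forall>(w, a)\<in>set q. y w = a"
      unfolding q encode_coding_def using xc y_map coding[OF c] by fastforce
    ultimately show "\<exists>y. admissible (e ` S) (d ` A) E (coding_lists e d C) y \<and>
        (\<forall>(w, a)\<in>set q. y w = a)" by blast
  next
    assume "\<exists>y. admissible (e ` S) (d ` A) E (coding_lists e d C) y \<and> (\<forall>(w, a)\<in>set q. y w = a)"
    then obtain y where adm: "admissible (e ` S) (d ` A) E (coding_lists e d C) y"
      and yq: "\<forall>(w, a)\<in>set q. y w = a" by blast
    have y: "\<And>u. u \<in> lists (e ` S) \<Longrightarrow> y u \<in> d ` A" "\<And>u v. (u, v) \<in> E \<Longrightarrow> y u = y v"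
      "\<And>r u. r \<in> coding_lists e d C \<Longrightarrow> u \<in> lists (e ` S) \<Longrightarrow> \<exists>(w, a)\<in>set r. y (u @ w) \<noteq> a"
      using adm unfolding admissible_def by blast+
    define word_of where "word_of g = (SOME w. w \<in> lists S \<and> word_value G w = g)" for g
    have word_of: "word_of g \<in> lists S" "word_value G (word_of g) = g" if "g \<in> carrier G" for g
      using someI_ex[OF word_value_surj[OF S that, unfolded Bex_def]] unfolding word_of_def by auto
    define x where "x = (\<lambda>g\<in>carrier G. inv_into A d (y (map e (word_of g))))"
    have map_lists: "map e w \<in> lists (e ` S)" if "w \<in> lists S" for w using that by auto
    have dx: "x (word_value G w) \<in> A" "d (x (word_value G w)) = y (map e w)" if w: "w \<in> lists S" for w
    proof -
      let ?g = "word_value G w"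
      have g: "?g \<in> carrier G" using lists_sub[OF w] by simp
      have "(map e (word_of ?g), map e w) \<in> E"
        using w word_of[OF g] by (auto simp: E_def value_map simp del: map_map)
      then have "y (map e (word_of ?g)) = y (map e w)" by (rule y(2))
      then have xg: "x ?g = inv_into A d (y (map e w))" using g by (simp add: x_def)
      have "y (map e w) \<in> d ` A" using y(1)[OF map_lists[OF w]] .
      then show "x ?g \<in> A" "d (x ?g) = y (map e w)"
        unfolding xg by (auto intro: inv_into_into f_inv_into_f)
    qed
    have "x \<in> configurations G A"
      unfolding configurations_eq
    proof (rule PiE_I)
      fix g assume "g \<in> carrier G"
      then show "x g \<in> A" using dx(1)[of "word_of g"] word_of[of g] by simp
    qed (simp add: x_def)
    moreover have "\<exists>(w, a)\<in>c'. x (g \<otimes> word_value G w) \<noteq> a"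
      if g: "g \<in> carrier G" and c': "c' \<in> C" for g c'
    proof -
      have "finite (encode_coding e d c')"
        using c' C_sub unfolding pattern_codings_def encode_coding_def by blast
      then obtain r where r: "distinct r" "set r = encode_coding e d c'"
        using finite_distinct_list by blast
      then have "r \<in> coding_lists e d C" using c' unfolding coding_lists_def by blast
      then have "\<exists>(w, a)\<in>set r. y (map e (word_of g) @ w) \<noteq> a"
        using y(3) map_lists[OF word_of(1)[OF g]] by blast
      then obtain w a where wa: "(w, a) \<in> c'" "y (map e (word_of g) @ map e w) \<noteq> d a"
        unfolding r(2) encode_coding_def by auto
      have w: "w \<in> lists S" using coding[of c' w a] c' C_sub wa(1) by blast
      have "word_of g @ w \<in> lists S" using word_of(1)[OF g] w by simp
      from dx(2)[OF this] have "d (x (word_value G (word_of g @ w))) \<noteq> d a" using wa(2) by simp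
      moreover have "word_value G (word_of g @ w) = g \<otimes> word_value G w"
        using word_value_append[OF lists_sub[OF word_of(1)[OF g]] lists_sub[OF w]] word_of(2)[OF g]
        by simp
      ultimately have "x (g \<otimes> word_value G w) \<noteq> a" by auto
      then show ?thesis using wa(1) by blast
    qed
    ultimately have "x \<in> X" unfolding X mem_defined_set_iff by blast
    moreover have "x (word_value G w) = a" if wa: "(w, a) \<in> c" for w a
    proof -
      have w: "w \<in> lists S" "a \<in> A" using coding[OF c wa] by auto
      have "(map e w, d a) \<in> set q" using wa unfolding q encode_coding_def by force
      then have "d (x (word_value G w)) = d a" using dx(2)[OF w(1)] yq by auto
      then show ?thesis using d dx(1)[OF w(1)] w(2) by (simp add: inj_on_eq_iff)
    qed
    ultimately show "\<exists>x\<in>X. \<forall>(w, a)\<in>c. x (word_value G w) = a" by blast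
  qed
qed

text \<open>A coding is avoided iff the lists that represent it are refutable, by soundness and
  completeness of refutations.\<close>

lemma recursively_enumerable_avoided_codings:
  assumes S: "symmetric_generating_set G S" and G: "recursively_presented G" and A: "finite A"
    and e: "inj_on e S" and d: "inj_on d A"
    and C: "codings_define G S A C X"
    and re: "recursively_enumerable (pattern_coding_code e d ` C)"
  shows "recursively_enumerable (pattern_coding_code e d ` avoided_codings G S A X)"
proof -
  define E where "E = {(u, v). u \<in> lists (e ` S) \<and> v \<in> lists (e ` S) \<and>
      decoded_value G S e u = decoded_value G S e v}"
  let ?ref = "refutable (e ` S) (d ` A) E (coding_lists e d C)"
  have fin: "finite S" using S unfolding symmetric_generating_set_def by blast
  have C_sub: "C \<subseteq> pattern_codings S A" using C unfolding codings_define_def by blast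
  have lists_sub: "set q \<subseteq> lists (e ` S) \<times> d ` A"
    if q: "set q = encode_coding e d c" and c: "c \<in> pattern_codings S A" for q c
  proof
    fix p assume "p \<in> set q"
    then obtain w a where "(w, a) \<in> c" "p = (map e w, d a)"
      unfolding q encode_coding_def by auto
    moreover from this have "w \<in> lists S" "a \<in> A" using c unfolding pattern_codings_def by blast+
    ultimately show "p \<in> lists (e ` S) \<times> d ` A" by auto
  qed
  have "semidecidable (\<lambda>p. p \<in> E)"
    using semidecidable_word_problem[OF S e G] unfolding E_def by (simp add: case_prod_beta)
  moreover have "semidecidable (\<lambda>q. q \<in> coding_lists e d C)"
    using re recursively_enumerable_codings_iff[of C e d] C_sub unfolding pattern_codings_def by blast
  ultimately have ref: "semidecidable ?ref"
    using fin A by (intro semidecidable_refutable) auto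
  have avoided_iff: "c \<in> avoided_codings G S A X \<longleftrightarrow> ?ref q"
    if c: "c \<in> pattern_codings S A" and q: "set q = encode_coding e d c" for c q
  proof -
    have "(\<exists>y. admissible (e ` S) (d ` A) E (coding_lists e d C) y \<and> (\<forall>(w, a)\<in>set q. y w = a)) \<longleftrightarrow> \<not> ?ref q"
    proof
      assume "\<not> ?ref q"
      then obtain y where "admissible (e ` S) (d ` A) E (coding_lists e d C) y" "\<forall>(w, a)\<in>set q. y w = a"
      proof (rule refutable_complete[rotated 4])
        show "set q \<subseteq> lists (e ` S) \<times> d ` A" using q c by (rule lists_sub)
        show "set r \<subseteq> lists (e ` S) \<times> d ` A" if "r \<in> coding_lists e d C" for r
          using that C_sub lists_sub unfolding coding_lists_def by blast
      qed (auto simp: E_def)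
      then show "\<exists>y. admissible (e ` S) (d ` A) E (coding_lists e d C) y \<and> (\<forall>(w, a)\<in>set q. y w = a)"
        by blast
    qed (use refutable_sound in blast)
    then show ?thesis
      using ex_config_iff_ex_labeling[OF S e d C c q] c unfolding E_def avoided_codings_def by blast
  qed
  have "q \<in> coding_lists e d (avoided_codings G S A X) \<longleftrightarrow>
      distinct q \<and> (\<forall>p\<in>set q. fst p \<in> lists (e ` S) \<and> snd p \<in> d ` A) \<and> ?ref q" for q
  proof
    assume "q \<in> coding_lists e d (avoided_codings G S A X)"
    then obtain c where c: "distinct q" "c \<in> avoided_codings G S A X" "set q = encode_coding e d c"
      unfolding coding_lists_def by blast
    then have "c \<in> pattern_codings S A" unfolding avoided_codings_def by blast
    then show "distinct q \<and> (\<forall>p\<in>set q. fst p \<in> lists (e ` S) \<and> snd p \<in> d ` A) \<and> ?ref q"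
      using c lists_sub[OF c(3)] avoided_iff[OF _ c(3)] by auto
  next
    assume q: "distinct q \<and> (\<forall>p\<in>set q. fst p \<in> lists (e ` S) \<and> snd p \<in> d ` A) \<and> ?ref q"
    define c where "c = (\<lambda>p. (map (inv_into S e) (fst p), inv_into A d (snd p))) ` set q"
    have "c \<in> pattern_codings S A"
      using q unfolding c_def pattern_codings_def by (auto simp: inv_into_into in_lists_conv_set)
    moreover have "encode_coding e d c = set q"
    proof -
      have "(map e (map (inv_into S e) (fst p)), d (inv_into A d (snd p))) = p" if "p \<in> set q" for p
      proof -
        have "map (\<lambda>n. e (inv_into S e n)) (fst p) = fst p"
          using q that by (intro map_idI f_inv_into_f) (auto simp: in_lists_conv_set)
        moreover have "d (inv_into A d (snd p)) = snd p" using q that by (intro f_inv_into_f) auto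
        ultimately show ?thesis by (simp add: comp_def)
      qed
      then show ?thesis unfolding encode_coding_def c_def image_image by force
    qed
    ultimately show "q \<in> coding_lists e d (avoided_codings G S A X)"
      using q avoided_iff[of c q] unfolding coding_lists_def by auto
  qed
  moreover have "semidecidable (\<lambda>q. distinct q \<and>
      (\<forall>p\<in>set q. fst p \<in> lists (e ` S) \<and> snd p \<in> d ` A) \<and> ?ref q)"
    by (intro semidecidable_conj ref semidecidable_computable computable_lists
        computable_finite_set finite_imageI fin A computable_intros)
  ultimately have "semidecidable (\<lambda>q. q \<in> coding_lists e d (avoided_codings G S A X))"
    by simp
  moreover have "\<And>c. c \<in> avoided_codings G S A X \<Longrightarrow> finite c"
    unfolding avoided_codings_def pattern_codings_def by blast
  ultimately show ?thesis using recursively_enumerable_codings_iff by blast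
qed

end

theorem lemma2p3:
  fixes G :: "('g, 'm) monoid_scheme"
    and S :: "'g set"
    and A :: "'a set"
    and X :: "('g \<Rightarrow> 'a) set"
  assumes "group G"
    and "symmetric_generating_set G S"
    and "recursively_presented G"
    and "finite A"
    and "subshift G A X"
    and "effectively_closed G S A X"
  shows "\<exists>C. re_pattern_codings S A C \<and> codings_define G S A C X \<and>
           (\<forall>C'. codings_define G S A C' X \<and> C \<subseteq> C' \<longrightarrow> C' = C)"
proof -
  interpret group G by fact
  have S: "S \<subseteq> carrier G" using assms(2) unfolding symmetric_generating_set_def by blast
  obtain C e d where C: "codings_define G S A C X" and "inj_on e S" "inj_on d A"
    "recursively_enumerable (pattern_coding_code e d ` C)"
    using assms(6) unfolding effectively_closed_def re_pattern_codings_def by blast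
  then have "re_pattern_codings S A (avoided_codings G S A X)"
    using recursively_enumerable_avoided_codings[OF assms(2-4)]
    unfolding re_pattern_codings_def by blast
  then show ?thesis
    using avoided_codings_define[OF S C assms(5)] codings_define_imp_subset_avoided[OF S]
    by (intro exI[of _ "avoided_codings G S A X"]) blast
qed

end
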